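(* Let $K$ be an algebraically closed field of characteristic $2$ and let $X\subset\mathbb{P}^3_K$ be a normal quartic surface given, in coordinates $(x_1,x_2,x_3,z)$, by an equation $$F(x,z)=\lambda z^4+z^2Q(x)+B(x)=0,$$ where $\lambda\in K$ and $Q,B\in K[x_1,x_2,x_3]$ are homogeneous of degrees $2$ and $4$. Then $|\mathrm{Sing}(X)|\le 16$.
   Context: Normal means irreducible with finitely many singular points. *)

theory Defs
  imports "HOL-Computational_Algebra.Polynomial"
begin

text \<open>Polynomials in four variables x1, x2, x3, z over a field are represented as
  nested univariate polynomials K[x1][x2][x3][z] (innermost variable x1, outermost z).\<close>

type_synonym 'a mpoly4 = "'a poly poly poly poly"

definition alg_closed :: "'a::field itself \<Rightarrow> bool" where
  "alg_closed _ \<longleftrightarrow> (\<forall>p::'a poly. degree p > 0 \<longrightarrow> (\<exists>x. poly p x = 0))"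

definition C4 :: "'a::comm_ring_1 \<Rightarrow> 'a mpoly4" where
  "C4 c = [:[:[:[:c:]:]:]:]"

definition X1 :: "'a::comm_ring_1 mpoly4" where "X1 = [:[:[:monom 1 1:]:]:]"
definition X2 :: "'a::comm_ring_1 mpoly4" where "X2 = [:[:monom 1 1:]:]"
definition X3 :: "'a::comm_ring_1 mpoly4" where "X3 = [:monom 1 1:]"
definition Z  :: "'a::comm_ring_1 mpoly4" where "Z = monom 1 1"

definition hom3 :: "nat \<Rightarrow> (nat \<Rightarrow> nat \<Rightarrow> nat \<Rightarrow> 'a::comm_ring_1) \<Rightarrow> 'a mpoly4" where
  "hom3 d c = (\<Sum>(i,j,k)\<in>{(i,j,k). i + j + k = d}. C4 (c i j k) * X1 ^ i * X2 ^ j * X3 ^ k)"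

definition eval4 :: "'a::comm_ring_1 mpoly4 \<Rightarrow> 'a \<times> 'a \<times> 'a \<times> 'a \<Rightarrow> 'a" where
  "eval4 F p = (case p of (x1, x2, x3, z) \<Rightarrow>
     poly (poly (poly (poly F [:[:[:z:]:]:]) [:[:x3:]:]) [:x2:]) x1)"

definition dZ :: "'a::field mpoly4 \<Rightarrow> 'a mpoly4" where "dZ F = pderiv F"
definition dX3 :: "'a::field mpoly4 \<Rightarrow> 'a mpoly4" where "dX3 F = map_poly pderiv F"
definition dX2 :: "'a::field mpoly4 \<Rightarrow> 'a mpoly4" where
  "dX2 F = map_poly (map_poly pderiv) F"
definition dX1 :: "'a::field mpoly4 \<Rightarrow> 'a mpoly4" where
  "dX1 F = map_poly (map_poly (map_poly pderiv)) F"

definition sing_reps :: "'a::field mpoly4 \<Rightarrow> ('a \<times> 'a \<times> 'a \<times> 'a) set" where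
  "sing_reps F = {p. p \<noteq> (0,0,0,0) \<and> eval4 F p = 0 \<and> eval4 (dX1 F) p = 0 \<and>
     eval4 (dX2 F) p = 0 \<and> eval4 (dX3 F) p = 0 \<and> eval4 (dZ F) p = 0}"

definition scale4 :: "'a::field \<Rightarrow> 'a \<times> 'a \<times> 'a \<times> 'a \<Rightarrow> 'a \<times> 'a \<times> 'a \<times> 'a" where
  "scale4 c p = (case p of (a, b, d, e) \<Rightarrow> (c * a, c * b, c * d, c * e))"

definition proj_rel :: "('a::field \<times> 'a \<times> 'a \<times> 'a) set \<Rightarrow> (('a \<times> 'a \<times> 'a \<times> 'a) \<times> ('a \<times> 'a \<times> 'a \<times> 'a)) set" where
  "proj_rel S = {(p, q). p \<in> S \<and> q \<in> S \<and> (\<exists>c. c \<noteq> 0 \<and> q = scale4 c p)}"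

definition Sing :: "'a::field mpoly4 \<Rightarrow> ('a \<times> 'a \<times> 'a \<times> 'a) set set" where
  "Sing F = sing_reps F // proj_rel (sing_reps F)"

definition normal_surface :: "'a::field mpoly4 \<Rightarrow> bool" where
  "normal_surface F \<longleftrightarrow> irreducible F \<and> finite (Sing F)"

end

theory Submission
  imports Defs "HOL-Library.Product_Plus"
begin

text \<open>
  In characteristic 2 every quartic form in \<open>x\<close> is, modulo the square of a quadratic form,
  \<open>x1 x2 \<alpha>\<^sup>2 + x1 x3 \<beta>\<^sup>2 + x2 x3 \<gamma>\<^sup>2\<close> with linear forms \<open>\<alpha>, \<beta>, \<gamma>\<close>, and the same holds for
  \<open>Q\<close> with constants. Hence \<open>F = x1 x2 p3\<^sup>2 + x1 x3 p2\<^sup>2 + x2 x3 p1\<^sup>2 + S\<^sup>2\<close> with linear forms \<open>p\<^sub>i\<close> and a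
  quadratic form \<open>S\<close> in \<open>(x, z)\<close>, and the gradient of \<open>F\<close> vanishes iff \<open>x\<close> is parallel to
  \<open>(p1\<^sup>2, p2\<^sup>2, p3\<^sup>2)\<close>. The singular points are therefore of three kinds: the vertex \<open>x = 0\<close> (only for
  \<open>\<lambda> = 0\<close>), the points with \<open>p = 0\<close> and \<open>S = 0\<close> (at most two, since a quadric in a projective
  space has at most two or infinitely many points), and the points which can be scaled to
  \<open>x = y\<^sup>2\<close> with \<open>y = p(y\<^sup>2, z) \<noteq> 0\<close> and \<open>y1 y2 y3 + S(y\<^sup>2, z) = 0\<close>.

  If the \<open>p\<^sub>i\<close> do not involve \<open>z\<close>, then \<open>y\<close> is a fixed vector of a Frobenius-semilinear map of \<open>K\<^sup>3\<close>.
  Linearly independent fixed vectors combine to a fixed vector only with coefficients 0 and 1, so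
  there are at most 7 such \<open>y\<close>, each with at most two \<open>z\<close>.
  Otherwise \<open>z\<close> can be eliminated, and there remain two equations, each of the form \<open>u = \<gamma>(u\<^sup>2)\<close>, and
  one quartic equation. Extracting square roots, the curve given by the first two equations is, in
  the generic case, parametrised by polynomials of degree at most 4 in one variable, and the quartic
  becomes a polynomial of degree at most 16 in it, which vanishes to order at least 2 at the
  irrelevant solution \<open>y = 0\<close> (order 3 if \<open>\<lambda> = 0\<close>). In the degenerate cases the curve splits into
  components of smaller degree with the same total bound.
\<close>

section \<open>Evaluation of the quartic and its partial derivatives\<close>

abbreviation mon4 :: "'a::comm_ring_1 \<Rightarrow> nat \<Rightarrow> nat \<Rightarrow> nat \<Rightarrow> nat \<Rightarrow> 'a mpoly4" where
  "mon4 c i j k l \<equiv> monom (monom (monom (monom c i) j) k) l"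

lemma C4_X_power_conv_mon4:
  "C4 c * X1 ^ i * X2 ^ j * X3 ^ k = mon4 c i j k 0"
  by (simp add: C4_def X1_def X2_def X3_def monom_0[symmetric] monom_power mult_monom
      flip: one_pCons)

lemma mon4_times: "mon4 a i j k l * mon4 b i' j' k' l' = mon4 (a * b) (i + i') (j + j') (k + k') (l + l')"
  by (simp add: mult_monom)

lemma eval4_mon4: "eval4 (mon4 c i j k l) (x1, x2, x3, z) = c * x1 ^ i * x2 ^ j * x3 ^ k * z ^ l"
  by (simp add: eval4_def poly_monom poly_const_pow)

lemma eval4_add: "eval4 (F + G) p = eval4 F p + eval4 G p"
  by (simp add: eval4_def split: prod.splits)

lemma map_poly_additive:
  assumes "\<And>x y. f (x + y) = f x + f y" "f 0 = 0"
  shows "map_poly f (p + q) = map_poly f p + map_poly f q"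
  by (rule poly_eqI) (simp add: coeff_map_poly assms)

lemma partial_add: "dX1 (F + G) = dX1 F + dX1 G" "dX2 (F + G) = dX2 F + dX2 G"
  "dX3 (F + G) = dX3 F + dX3 G" "dZ (F + G) = dZ F + dZ G"
  by (simp_all add: dX1_def dX2_def dX3_def dZ_def map_poly_additive pderiv_add)

lemma partial_mon4:
  "dX1 (mon4 c i j k l) = mon4 (of_nat i * c) (i - 1) j k l"
  "dX2 (mon4 c i j k l) = mon4 (of_nat j * c) i (j - 1) k l"
  "dX3 (mon4 c i j k l) = mon4 (of_nat k * c) i j (k - 1) l"
  "dZ (mon4 c i j k l) = mon4 (of_nat l * c) i j k (l - 1)"
  by (simp_all add: dX1_def dX2_def dX3_def dZ_def map_poly_monom pderiv_monom
      of_nat_poly monom_0[symmetric] mult_monom)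

lemma hom3_expand:
  "hom3 d c = (\<Sum>i\<le>d. \<Sum>j\<le>d - i. mon4 (c i j (d - i - j)) i j (d - i - j) 0)"
proof -
  have eq: "{(i,j,k). i + j + k = d} = (\<lambda>(i,j). (i, j, d - i - j)) ` Sigma {..d} (\<lambda>i. {..d - i})"
    by (force simp: image_iff)
  have inj: "inj_on (\<lambda>(i,j). (i, j, d - i - j)) (Sigma {..d} (\<lambda>i. {..d - i}))"
    by (auto simp: inj_on_def)
  show ?thesis
    unfolding hom3_def eq
    by (subst sum.reindex[OF inj]) (simp add: sum.Sigma C4_X_power_conv_mon4 o_def case_prod_unfold)
qed

text \<open>In characteristic 2 squares have zero derivative. As \<open>z\<close> enters only
  through \<open>z^2\<close> and \<open>z^4\<close>, the derivative by \<open>z\<close> vanishes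
  identically. The other three retain only the terms divisible by \<open>x1 x2\<close>,
  \<open>x1 x3\<close> or \<open>x2 x3\<close>, whose cofactors are combinations of squares and
  behave as constants.\<close>

lemma mem_sing_reps_iff:
  fixes lam :: "'a::field"
  assumes two: "(2::'a) = 0"
    and F: "F = C4 lam * Z ^ 4 + Z ^ 2 * hom3 2 q + hom3 4 b"
  shows "(x1, x2, x3, z) \<in> sing_reps F \<longleftrightarrow> (x1, x2, x3, z) \<noteq> (0, 0, 0, 0) \<and>
    lam * z^4 + z^2 * (q 2 0 0 * x1^2 + q 0 2 0 * x2^2 + q 0 0 2 * x3^2
       + q 1 1 0 * x1 * x2 + q 1 0 1 * x1 * x3 + q 0 1 1 * x2 * x3)
     + b 4 0 0 * x1^4 + b 0 4 0 * x2^4 + b 0 0 4 * x3^4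
     + b 2 2 0 * x1^2 * x2^2 + b 2 0 2 * x1^2 * x3^2 + b 0 2 2 * x2^2 * x3^2
     + x1 * x2 * (b 3 1 0 * x1^2 + b 1 3 0 * x2^2 + b 1 1 2 * x3^2)
     + x1 * x3 * (b 3 0 1 * x1^2 + b 1 2 1 * x2^2 + b 1 0 3 * x3^2)
     + x2 * x3 * (b 2 1 1 * x1^2 + b 0 3 1 * x2^2 + b 0 1 3 * x3^2) = 0 \<and>
    x2 * (b 3 1 0 * x1^2 + b 1 3 0 * x2^2 + b 1 1 2 * x3^2 + q 1 1 0 * z^2)
     + x3 * (b 3 0 1 * x1^2 + b 1 2 1 * x2^2 + b 1 0 3 * x3^2 + q 1 0 1 * z^2) = 0 \<and>
    x1 * (b 3 1 0 * x1^2 + b 1 3 0 * x2^2 + b 1 1 2 * x3^2 + q 1 1 0 * z^2)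
     + x3 * (b 2 1 1 * x1^2 + b 0 3 1 * x2^2 + b 0 1 3 * x3^2 + q 0 1 1 * z^2) = 0 \<and>
    x1 * (b 3 0 1 * x1^2 + b 1 2 1 * x2^2 + b 1 0 3 * x3^2 + q 1 0 1 * z^2)
     + x2 * (b 2 1 1 * x1^2 + b 0 3 1 * x2^2 + b 0 1 3 * x3^2 + q 0 1 1 * z^2) = 0"
proof -
  have n3: "(3::'a) = 1" and n4: "(4::'a) = 0"
    using arg_cong[OF two, of "\<lambda>x. x + 1"] arg_cong[OF two, of "\<lambda>x. x + x"] by simp_all
  have Z: "Z = (mon4 1 0 0 0 1 :: 'a mpoly4)" and C: "C4 lam = mon4 lam 0 0 0 0"
    by (simp_all add: Z_def C4_def monom_0 flip: one_pCons)
  have Zp: "Z ^ n = (mon4 1 0 0 0 n :: 'a mpoly4)" for n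
    unfolding Z by (simp add: monom_power)
  have F': "F = mon4 lam 0 0 0 4
     + mon4 (q 2 0 0) 2 0 0 2 + mon4 (q 0 2 0) 0 2 0 2 + mon4 (q 0 0 2) 0 0 2 2
     + mon4 (q 1 1 0) 1 1 0 2 + mon4 (q 1 0 1) 1 0 1 2 + mon4 (q 0 1 1) 0 1 1 2
     + mon4 (b 4 0 0) 4 0 0 0 + mon4 (b 0 4 0) 0 4 0 0 + mon4 (b 0 0 4) 0 0 4 0
     + mon4 (b 2 2 0) 2 2 0 0 + mon4 (b 2 0 2) 2 0 2 0 + mon4 (b 0 2 2) 0 2 2 0
     + mon4 (b 3 1 0) 3 1 0 0 + mon4 (b 1 3 0) 1 3 0 0 + mon4 (b 1 1 2) 1 1 2 0
     + mon4 (b 3 0 1) 3 0 1 0 + mon4 (b 1 2 1) 1 2 1 0 + mon4 (b 1 0 3) 1 0 3 0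
     + mon4 (b 2 1 1) 2 1 1 0 + mon4 (b 0 3 1) 0 3 1 0 + mon4 (b 0 1 3) 0 1 3 0"
    unfolding F Zp C mon4_times hom3_expand
    by (simp add: numeral_eq_Suc distrib_left mult_monom ac_simps)
  have n: "of_nat 4 = (0::'a)" "of_nat 3 = (1::'a)" "of_nat 2 = (0::'a)"
    using two n3 n4 by simp_all
  show ?thesis
    unfolding sing_reps_def F' mem_Collect_eq partial_add eval4_add partial_mon4 eval4_mon4 n
    by (simp only: of_nat_0 of_nat_1 mult_zero_left mult_1_left mult_1_right power_0 add_0_left add_0_right
      diff_self_eq_0 diff_0_eq_0 power_one_right numeral_eq_Suc diff_Suc_1 pred_numeral_simps
      BitM.simps One_nat_def[symmetric])
      (simp add: algebra_simps)
qed

section \<open>Polynomial functions with prescribed order and degree\<close>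

text \<open>Here \<open>m\<close> is a lower bound for the order of vanishing at 0. With functions
  instead of polynomials, the closure rules below read off order and degree of a composition from
  its term.\<close>

definition polyfun :: "nat \<Rightarrow> nat \<Rightarrow> ('a::field \<Rightarrow> 'a) \<Rightarrow> bool" where
  "polyfun m d f \<longleftrightarrow> (\<exists>p. degree p \<le> d \<and> monom 1 m dvd p \<and> f = poly p)"

lemma polyfun_mono: "polyfun m d (f :: 'a::field \<Rightarrow> 'a) \<Longrightarrow> m' \<le> m \<Longrightarrow> d \<le> d' \<Longrightarrow> polyfun m' d' f"
  by (auto simp: polyfun_def monom_altdef intro: dvd_trans[OF le_imp_power_dvd] le_trans)

lemma polyfun_add: "polyfun m d f \<Longrightarrow> polyfun m d g \<Longrightarrow> polyfun m d (\<lambda>r. f r + g r)"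
  unfolding polyfun_def
  by (elim exE conjE, rule_tac x = "p + pa" in exI) (auto intro: degree_add_le)

lemma polyfun_mult:
  assumes "polyfun m d f" "polyfun m' d' g"
  shows "polyfun (m + m') (d + d') (\<lambda>r. f r * g r)"
proof -
  obtain p p' where "degree p \<le> d" "monom 1 m dvd p" "f = poly p"
    "degree p' \<le> d'" "monom 1 m' dvd p'" "g = poly p'"
    using assms unfolding polyfun_def by blast
  moreover have "monom (1::'a) (m + m') = monom 1 m * monom 1 m'" by (simp add: mult_monom)
  ultimately show ?thesis
    unfolding polyfun_def
    by (intro exI[of _ "p * p'"])
       (auto intro: mult_dvd_mono degree_mult_le[THEN le_trans] add_mono)
qed

lemma polyfun_const: "polyfun 0 d (\<lambda>r. c)"
  unfolding polyfun_def by (rule exI[of _ "[:c:]"]) (auto simp: monom_0 simp flip: one_pCons)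

lemma polyfun_zero: "polyfun m d (\<lambda>r. 0)"
  unfolding polyfun_def by (rule exI[of _ 0]) auto

lemma polyfun_id: "polyfun 1 1 (\<lambda>r. r)"
  unfolding polyfun_def by (rule exI[of _ "[:0, 1:]"]) (auto simp: monom_altdef)

lemma polyfun_cmult: "polyfun m d f \<Longrightarrow> polyfun m d (\<lambda>r. c * f r)"
  using polyfun_mult[OF polyfun_const[of 0 c]] by simp

lemma polyfun_divide: "polyfun m d f \<Longrightarrow> polyfun m d (\<lambda>r. f r / c)"
  using polyfun_cmult[of m d f "inverse c"] by (simp add: field_simps)

lemma polyfun_power2: "polyfun m d f \<Longrightarrow> polyfun (2 * m) (2 * d) (\<lambda>r. (f r)^2)"
  using polyfun_mult[of m d f m d f] by (simp add: power2_eq_square mult_2)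

lemma polyfun_power4: "polyfun m d f \<Longrightarrow> polyfun (4 * m) (4 * d) (\<lambda>r. (f r)^4)"
  using polyfun_power2[OF polyfun_power2, of m d f] by (simp flip: power_mult)

lemma polyfun_power2_weak: "polyfun m d f \<Longrightarrow> polyfun m (2 * d) (\<lambda>r. (f r)^2)"
  by (rule polyfun_mono[OF polyfun_power2]) auto

text \<open>Dividing by \<open>monom 1 m\<close> discards only the root 0 and lowers the degree by
  \<open>m\<close>; finiteness of the root set excludes the zero polynomial.\<close>

lemma card_polyfun_roots:
  fixes f :: "'a::field \<Rightarrow> 'a"
  assumes f: "polyfun m d f" and inf: "infinite (UNIV :: 'a set)"
    and fin: "finite {r. r \<noteq> 0 \<and> f r = 0}"
  shows "card {r. r \<noteq> 0 \<and> f r = 0} \<le> d - m"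
proof -
  obtain q where q: "degree (monom 1 m * q) \<le> d" "f = poly (monom 1 m * q)"
    using f unfolding polyfun_def dvd_def by metis
  have "q \<noteq> 0"
  proof
    assume "q = 0"
    then have "{r. r \<noteq> 0 \<and> f r = 0} = UNIV - {0}" using q by auto
    with fin inf show False by simp
  qed
  then have "degree q \<le> d - m" using q by (simp add: degree_mult_eq degree_monom_eq monom_eq_0_iff)
  moreover have "card {r. r \<noteq> 0 \<and> f r = 0} \<le> card {r. poly q r = 0}"
    using \<open>q \<noteq> 0\<close> by (intro card_mono poly_roots_finite) (auto simp: q poly_monom)
  moreover have "card {r. poly q r = 0} \<le> degree q"
    using \<open>q \<noteq> 0\<close> by (rule card_poly_roots_bound)
  ultimately show ?thesis by linarith
qed

lemma card_polyfun_roots0: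
  fixes f :: "'a::field \<Rightarrow> 'a"
  assumes f: "polyfun 0 d f" and inf: "infinite (UNIV :: 'a set)" and fin: "finite {r. f r = 0}"
  shows "card {r. f r = 0} \<le> d"
proof -
  obtain q where q: "degree q \<le> d" "f = poly q"
    using f unfolding polyfun_def by metis
  have "q \<noteq> 0" using q fin inf by auto
  then show ?thesis using card_poly_roots_bound[of q] q by simp
qed

text \<open>This says that \<open>h\<close> is a polynomial of degree at most 4 all of whose monomials have degree at
  least \<open>k\<close>, in terms of substitutions instead of polynomials in three variables. Only \<open>m = 0\<close>
  (constants are allowed) and \<open>m = 1\<close> (all arguments vanish at 0) are needed.\<close>

definition quartic_ord :: "nat \<Rightarrow> ('a::field \<Rightarrow> 'a \<Rightarrow> 'a \<Rightarrow> 'a) \<Rightarrow> bool" where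
  "quartic_ord k h \<longleftrightarrow> (\<forall>m d u v w. m \<le> 1 \<longrightarrow> polyfun m d u \<longrightarrow> polyfun m d v \<longrightarrow> polyfun m d w
     \<longrightarrow> polyfun (k * m) (4 * d) (\<lambda>r. h (u r) (v r) (w r)))"

lemmas quartic_ordD = quartic_ord_def[THEN iffD1, rule_format]

lemma quartic_ord_swap: "quartic_ord k h \<Longrightarrow> quartic_ord k (\<lambda>u v w. h v u w)"
  by (simp add: quartic_ord_def)

text \<open>Serves two changes of variables: removing \<open>w\<close> from the first equation of a
  system, and eliminating \<open>z\<close> from the equations for the root solutions.\<close>

lemma quartic_ord_linear:
  assumes "quartic_ord k h"
  shows "quartic_ord k (\<lambda>u v w. h (u + c * v + e * w) (v + c' * w) w)"
  unfolding quartic_ord_def by (intro allI impI quartic_ordD[OF assms] polyfun_add polyfun_cmult) auto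

section \<open>Fields of characteristic two\<close>

text \<open>Expand \<open>v\<close> in a maximal independent set of fixed vectors. Comparing
  coefficients in \<open>T v = v\<close> gives \<open>c = c^2\<close>, so \<open>v\<close> is the
  sum of a subset of that set.\<close>

lemma (in vector_space) card_semilinear_fixed:
  assumes add: "\<And>v w. T (v + w) = T v + T w"
    and scale: "\<And>c v. T (scale c v) = scale (c ^ 2) (T v)"
    and S: "finite S" "span S = UNIV"
  shows "finite {v. T v = v} \<and> card {v. T v = v} \<le> 2 ^ card S"
proof -
  obtain B where B: "B \<subseteq> {v. T v = v}" "independent B" "{v. T v = v} \<subseteq> span B"
    "card B = dim {v. T v = v}"
    using basis_exists by blast
  have fin: "finite B" and cB: "card B \<le> card S"
    using independent_span_bound[OF S(1) B(2)] S(2) by auto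
  have T0: "T 0 = 0" using scale[of 0 0] by simp
  have Tsum: "T (\<Sum>x\<in>A. f x) = (\<Sum>x\<in>A. T (f x))" for f and A :: "'b set"
    by (induction A rule: infinite_finite_induct) (auto simp: add T0)
  have "{v. T v = v} \<subseteq> (\<lambda>A. \<Sum>A) ` Pow B"
  proof
    fix v assume v: "v \<in> {v. T v = v}"
    then have "v \<in> span B" using B(3) by auto
    then obtain c where c: "v = (\<Sum>x\<in>B. scale (c x) x)"
      unfolding span_finite[OF fin] by auto
    have "(\<Sum>x\<in>B. scale (c x) x) = T v" using v c by simp
    also have "\<dots> = (\<Sum>x\<in>B. scale ((c x)^2) x)"
      unfolding c Tsum using B(1) by (intro sum.cong) (auto simp: scale)
    finally have "(\<Sum>x\<in>B. scale (c x - (c x)^2) x) = 0"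
      by (simp add: scale_left_diff_distrib sum_subtractf)
    then have "c x - (c x)^2 = 0" if "x \<in> B" for x
      using independentD[OF B(2) fin order_refl, of "\<lambda>x. c x - (c x)^2"] that by blast
    then have "c x * (1 - c x) = 0" if "x \<in> B" for x
      using that by (simp add: algebra_simps power2_eq_square)
    then have "c x = 0 \<or> c x = 1" if "x \<in> B" for x
      using that by fastforce
    then have "v = (\<Sum>x\<in>B. if c x = 1 then x else 0)"
      unfolding c by (intro sum.cong) auto
    also have "\<dots> = \<Sum>{x\<in>B. c x = 1}"
      using fin by (simp add: sum.If_cases Int_def)
    finally show "v \<in> (\<lambda>A. \<Sum>A) ` Pow B" by blast
  qed
  moreover have "card ((\<lambda>A. \<Sum>A) ` Pow B) \<le> 2 ^ card B"
    using card_image_le[of "Pow B"] fin by (simp add: card_Pow)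
  moreover have "(2::nat) ^ card B \<le> 2 ^ card S" using cB by simp
  ultimately show ?thesis
    using fin by (meson card_mono finite_Pow_iff finite_imageI finite_subset le_trans)
qed

locale char2_closed =
  fixes ty :: "'a::field itself"
  assumes closed: "alg_closed TYPE('a)" and two: "(2::'a) = 0"
begin

lemma add_self: "x + x = (0::'a)"
  using two by (metis mult_2 mult_zero_left)

lemma three: "(3::'a) = 1"
  using arg_cong[OF two, of "\<lambda>x. x + 1"] by simp

lemma add_self_left: "x + (x + y) = (y::'a)"
  by (simp add: add_self flip: add.assoc)

lemma uminus_eq: "- x = (x::'a)"
  using add_self[of x] by (rule minus_unique)

lemma diff_eq: "x - y = x + (y::'a)"
  using uminus_eq[of y] by (metis diff_conv_add_uminus)

lemma square_add: "(x + y)^2 = x^2 + (y::'a)^2"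
  by (simp add: power2_sum two)

lemma eq_iff_add_eq_0: "x = y \<longleftrightarrow> x + y = (0::'a)"
  unfolding diff_eq[symmetric] by (rule eq_iff_diff_eq_0)

lemmas char2 = add_self add_self_left uminus_eq diff_eq square_add

lemma square_eq_iff: "x^2 = y^2 \<longleftrightarrow> x = (y::'a)"
  using square_add[of x y] eq_iff_add_eq_0[of x y] eq_iff_add_eq_0[of "x^2" "y^2"] by auto

text \<open>By \<open>square_eq_iff\<close> square roots are unique, so this choice is the inverse
  of the Frobenius map.\<close>

definition sq :: "'a \<Rightarrow> 'a" where "sq a = (SOME x. x ^ 2 = a)"

lemma sq_square [simp]: "(sq a)^2 = a"
proof -
  have "degree [:- a, 0, 1:] > 0" by simp
  then obtain x where "poly [:- a, 0, 1:] x = 0" using closed unfolding alg_closed_def by metis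
  then have "x^2 = a" by (simp add: power2_eq_square)
  then show ?thesis unfolding sq_def by (rule someI)
qed

text \<open>Over a finite field the product of all \<open>X - a\<close>, plus 1, would be a
  polynomial of positive degree without a root.\<close>

lemma infinite_UNIV: "infinite (UNIV :: 'a set)"
proof
  assume fin: "finite (UNIV :: 'a set)"
  let ?p = "(\<Prod>a\<in>(UNIV :: 'a set). [:- a, 1:])"
  have "degree ?p = card (UNIV :: 'a set)" by (simp add: degree_prod_eq_sum_degree)
  moreover have "card (UNIV :: 'a set) > 0" using fin by (simp add: card_gt_0_iff)
  ultimately have "degree (?p + 1) > 0" by (simp add: degree_add_eq_left)
  then obtain x where "poly (?p + 1) x = 0" using closed unfolding alg_closed_def by metis
  then show False using fin by (simp add: poly_prod prod_zero)
qed

lemma card_fixed2: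
  fixes g1 g2 b1 b2 :: 'a
  defines "Y \<equiv> {(u,v). u = g1 * u^2 + g2 * v^2 \<and> v = b1 * u^2 + b2 * v^2}"
  shows "finite Y \<and> card Y \<le> 4"
proof -
  \<comment> \<open>Coordinatewise scaling makes the pairs the vector space \<open>K^2\<close>, in
    which \<open>Y\<close> is the set of fixed vectors of a Frobenius-semilinear map.\<close>
  define sc where "sc = (\<lambda>c::'a. \<lambda>(u::'a,v::'a). (c * u, c * v))"
  interpret V: vector_space sc
    by unfold_locales (auto simp: sc_def algebra_simps)
  define T where "T = (\<lambda>(u,v). (g1 * u^2 + g2 * v^2, b1 * u^2 + b2 * v^2))"
  have "v \<in> V.span {(1,0),(0,1)}" for v
  proof -
    have *: "v = sc (fst v) (1,0) + sc (snd v) (0,1)" by (cases v) (simp add: sc_def)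
    show ?thesis
      by (subst *) (intro V.span_add V.span_scale V.span_base; simp)
  qed
  then have "finite {v. T v = v} \<and> card {v. T v = v} \<le> 2 ^ card {(1::'a,0::'a),(0,1)}"
    by (intro V.card_semilinear_fixed)
       (auto simp: T_def sc_def algebra_simps square_add power_mult_distrib)
  moreover have "{v. T v = v} = Y"
    by (auto simp: T_def Y_def)
  ultimately show ?thesis by simp
qed

lemma card_fixed3:
  fixes a1 a2 a3 b1 b2 b3 c1 c2 c3 :: 'a
  defines "Y \<equiv> {(u,v,w). u = a1 * u^2 + a2 * v^2 + a3 * w^2 \<and> v = b1 * u^2 + b2 * v^2 + b3 * w^2
     \<and> w = c1 * u^2 + c2 * v^2 + c3 * w^2}"
  shows "finite Y \<and> card Y \<le> 8"
proof -
  define sc where "sc = (\<lambda>c::'a. \<lambda>(u::'a,v::'a,w::'a). (c * u, c * v, c * w))"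
  interpret V: vector_space sc
    by unfold_locales (auto simp: sc_def algebra_simps)
  define T where "T = (\<lambda>(u,v,w). (a1 * u^2 + a2 * v^2 + a3 * w^2, b1 * u^2 + b2 * v^2 + b3 * w^2,
     c1 * u^2 + c2 * v^2 + c3 * w^2))"
  let ?S = "{(1,0,0),(0,1,0),(0,0,1)} :: ('a \<times> 'a \<times> 'a) set"
  have "v \<in> V.span ?S" for v
  proof -
    have *: "v = sc (fst v) (1,0,0) + (sc (fst (snd v)) (0,1,0) + sc (snd (snd v)) (0,0,1))"
      by (cases v) (simp add: sc_def)
    show ?thesis
      by (subst *) (intro V.span_add V.span_scale V.span_base; simp)
  qed
  then have "finite {v. T v = v} \<and> card {v. T v = v} \<le> 2 ^ card ?S"
    by (intro V.card_semilinear_fixed)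
       (auto simp: T_def sc_def algebra_simps square_add power_mult_distrib)
  moreover have "{v. T v = v} = Y"
    by (auto simp: T_def Y_def)
  ultimately show ?thesis by simp
qed

section \<open>Common solutions of two equations with Frobenius and a quartic\<close>

lemma card_image_polyfun_roots:
  fixes f :: "'a \<Rightarrow> 'a"
  assumes "polyfun m d f" "S = g ` {r. r \<noteq> 0 \<and> f r = 0}" "inj g" "finite S"
  shows "card S \<le> d - m"
proof -
  have inj: "inj_on g {r. r \<noteq> 0 \<and> f r = 0}" using assms(3) by (rule inj_on_subset) auto
  have "finite {r. r \<noteq> 0 \<and> f r = 0}" using finite_imageD[OF _ inj] assms by simp
  then show ?thesis
    using card_polyfun_roots[OF assms(1) infinite_UNIV] card_image[OF inj] assms(2) by simp
qed

lemma card_image_polyfun_roots0: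
  fixes f :: "'a \<Rightarrow> 'a"
  assumes "polyfun 0 d f" "S = g ` {r. f r = 0}" "inj g" "finite S"
  shows "card S \<le> d"
proof -
  have inj: "inj_on g {r. f r = 0}" using assms(3) by (rule inj_on_subset) auto
  have "finite {r. f r = 0}" using finite_imageD[OF _ inj] assms by simp
  then show ?thesis
    using card_polyfun_roots0[OF assms(1) infinite_UNIV] card_image[OF inj] assms(2) by simp
qed

text \<open>With \<open>v = t^2\<close>, the square root of the second equation gives
  \<open>w\<close> as a polynomial of degree at most 2 in \<open>t\<close>, so \<open>h\<close>
  becomes a polynomial of degree at most 8. For \<open>u0 = 0\<close> all arguments vanish at
  \<open>t = 0\<close>, which is the excluded origin and takes away the order
  \<open>k\<close>.\<close>

lemma card_solutions_line:
  fixes h :: "'a \<Rightarrow> 'a \<Rightarrow> 'a \<Rightarrow> 'a"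
  assumes h: "quartic_ord k h" and b3: "b3 \<noteq> 0"
    and S: "S = {(u,v,w). (u,v,w) \<noteq> (0,0,0) \<and> u = u0 \<and>
      v = b1 * u^2 + b2 * v^2 + b3 * w^2 \<and> h u v w = 0}"
    and fin: "finite S"
  shows "card S \<le> (if u0 = 0 then 8 - k else 8)"
proof -
  define W where "W = (\<lambda>t. (t + sq b1 * u0 + sq b2 * t^2) / sq b3)"
  define g where "g = (\<lambda>t. (u0, t^2, W t))"
  have inj: "inj g" by (auto simp: inj_on_def g_def square_eq_iff)
  have W: "b3 * (W t)^2 = t^2 + b1 * u0^2 + b2 * (t^2)^2" for t
    using b3 by (simp add: W_def power_divide square_add power_mult_distrib)
  have eq: "t^2 = b1 * u0^2 + b2 * (t^2)^2 + b3 * w^2 \<longleftrightarrow> w = W t" for t w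
  proof -
    have "t^2 = b1 * u0^2 + b2 * (t^2)^2 + b3 * w^2 \<longleftrightarrow> b3 * w^2 = b3 * (W t)^2"
      unfolding W eq_iff_add_eq_0[of "t^2"] eq_iff_add_eq_0[of "b3 * w^2"] by (simp add: ac_simps)
    also have "\<dots> \<longleftrightarrow> w = W t" using b3 by (simp add: square_eq_iff)
    finally show ?thesis .
  qed
  have sol: "(u,v,w) \<in> S \<longleftrightarrow> (\<exists>t. (u,v,w) = g t \<and> (u0 = 0 \<longrightarrow> t \<noteq> 0) \<and> h u0 (t^2) (W t) = 0)"
    for u v w
  proof -
    have "(u,v,w) \<in> S \<longleftrightarrow> (\<exists>t. v = t^2 \<and> (u,v,w) \<in> S)"
      by (metis sq_square)
    also have "\<dots> \<longleftrightarrow> (\<exists>t. v = t^2 \<and> u = u0 \<and> w = W t \<and> (u0, t^2, W t) \<noteq> (0,0,0) \<and> h u0 (t^2) (W t) = 0)"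
      unfolding S using eq by auto
    also have "\<dots> \<longleftrightarrow> (\<exists>t. (u,v,w) = g t \<and> (u0 = 0 \<longrightarrow> t \<noteq> 0) \<and> h u0 (t^2) (W t) = 0)"
      by (auto simp: g_def W_def)
    finally show ?thesis .
  qed
  show ?thesis
  proof (cases "u0 = 0")
    case True
    have *: "polyfun 1 2 (\<lambda>t::'a. t^2)" by (rule polyfun_mono[OF polyfun_power2[OF polyfun_id]]) auto
    have "polyfun (k * 1) (4 * 2) (\<lambda>t. h u0 (t^2) (W t))"
      unfolding True W_def
      by (intro quartic_ordD[OF h] polyfun_zero polyfun_divide polyfun_add polyfun_cmult * polyfun_mono[OF polyfun_id]) auto
    moreover have "S = g ` {t. t \<noteq> 0 \<and> h u0 (t^2) (W t) = 0}"
      using sol True by (auto simp: image_iff)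
    ultimately have "card S \<le> 4 * 2 - k * 1"
      using inj fin by (intro card_image_polyfun_roots)
    with True show ?thesis by simp
  next
    case False
    have *: "polyfun 0 2 (\<lambda>t::'a. t^2)" by (rule polyfun_mono[OF polyfun_power2[OF polyfun_id]]) auto
    have "polyfun (k * 0) (4 * 2) (\<lambda>t. h u0 (t^2) (W t))"
      unfolding W_def
      by (intro quartic_ordD[OF h] polyfun_const polyfun_divide polyfun_add polyfun_cmult * polyfun_mono[OF polyfun_id]) auto
    then have "polyfun 0 8 (\<lambda>t. h u0 (t^2) (W t))" by simp
    moreover have "S = g ` {t. h u0 (t^2) (W t) = 0}"
      using sol False by (auto simp: image_iff)
    ultimately have "card S \<le> 8"
      using inj fin by (intro card_image_polyfun_roots0)
    with False show ?thesis by simp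
  qed
qed

text \<open>Without \<open>w\<close> in the first equation the system is triangular. If
  \<open>g2 = 0\<close>, the first equation allows only \<open>u = 0\<close> and
  \<open>u = inverse g1\<close>, with at most \<open>8 - k\<close> and 8 solutions. Otherwise one
  parameter describes the whole curve.\<close>

lemma card_solutions_curve0:
  fixes h :: "'a \<Rightarrow> 'a \<Rightarrow> 'a \<Rightarrow> 'a"
  assumes h: "quartic_ord k h" and k: "k \<le> 8" and b3: "b3 \<noteq> 0"
    and S: "S = {(u,v,w). (u,v,w) \<noteq> (0,0,0) \<and> u = g1 * u^2 + g2 * v^2 \<and>
      v = b1 * u^2 + b2 * v^2 + b3 * w^2 \<and> h u v w = 0}"
    and fin: "finite S"
  shows "card S \<le> 16 - k"
proof (cases "g2 = 0")
  case True
  let ?L = "\<lambda>u0. {(u,v,w). (u,v,w) \<noteq> (0,0,0) \<and> u = u0 \<and>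
      v = b1 * u^2 + b2 * v^2 + b3 * w^2 \<and> h u v w = 0}"
  have L: "finite (?L u0) \<Longrightarrow> card (?L u0) \<le> (if u0 = 0 then 8 - k else 8)" for u0
    using card_solutions_line[OF h b3 refl] .
  have u: "u = g1 * u^2 \<longleftrightarrow> u = 0 \<or> (g1 \<noteq> 0 \<and> u = inverse g1)" for u
  proof -
    have "u = g1 * u^2 \<longleftrightarrow> u = 0 \<or> g1 * u = 1" by (auto simp: power2_eq_square)
    moreover have "g1 * u = 1 \<longleftrightarrow> g1 \<noteq> 0 \<and> u = inverse g1" by (auto simp: inverse_unique)
    ultimately show ?thesis by simp
  qed
  have S': "S = ?L 0 \<union> (if g1 = 0 then {} else ?L (inverse g1))"
    unfolding S True using u by auto
  have "card S \<le> card (?L 0) + card (if g1 = 0 then {} else ?L (inverse g1))"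
    unfolding S' by (rule card_Un_le)
  moreover have "card (?L 0) \<le> 8 - k" using L[of 0] fin S' by simp
  moreover have "card (if g1 = 0 then {} else ?L (inverse g1)) \<le> 8"
    using L[of "inverse g1"] fin S' by (cases "g1 = 0") auto
  ultimately show ?thesis using k by linarith
next
  case g2: False
  \<comment> \<open>The parameter \<open>r\<close> satisfies \<open>u = r ^ 4\<close>: the first equation expresses \<open>v\<close> through the square
    root of \<open>u\<close>, and the second one expresses \<open>w\<close> through the square root of \<open>v\<close>.\<close>
  define T where "T = (\<lambda>r. (r + sq (sq g1) * r^2) / sq (sq g2))"
  define W where "W = (\<lambda>r. (T r + sq b1 * r^4 + sq b2 * (T r)^2) / sq b3)"
  define g where "g = (\<lambda>r. (r^4, (T r)^2, W r))"
  have p4: "x^4 = (x^2)^2" for x :: 'a by simp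
  have inj: "inj g"
  proof (rule injI)
    fix r s assume "g r = g s"
    then have "(r^2)^2 = (s^2)^2" by (simp only: g_def prod.inject p4)
    then show "r = s" by (simp only: square_eq_iff)
  qed
  have T: "g2 * ((T r)^2)^2 = r^4 + g1 * (r^4)^2" for r
    using g2 unfolding p4 by (simp only: T_def power_divide square_add power_mult_distrib sq_square) simp
  have W: "b3 * (W r)^2 = (T r)^2 + b1 * (r^4)^2 + b2 * ((T r)^2)^2" for r
    using b3 by (simp only: W_def power_divide square_add power_mult_distrib sq_square) simp
  have eq1: "r^4 = g1 * (r^4)^2 + g2 * v^2 \<longleftrightarrow> v = (T r)^2" for r v
  proof -
    have "r^4 = g1 * (r^4)^2 + g2 * v^2 \<longleftrightarrow> g2 * v^2 = g2 * ((T r)^2)^2"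
      unfolding T eq_iff_add_eq_0[of "r^4"] eq_iff_add_eq_0[of "g2 * v^2"] by (simp only: ac_simps)
    also have "\<dots> \<longleftrightarrow> v = (T r)^2" using g2 by (simp only: mult_cancel_left square_eq_iff) simp
    finally show ?thesis .
  qed
  have eq2: "(T r)^2 = b1 * (r^4)^2 + b2 * ((T r)^2)^2 + b3 * w^2 \<longleftrightarrow> w = W r" for r w
  proof -
    have "(T r)^2 = b1 * (r^4)^2 + b2 * ((T r)^2)^2 + b3 * w^2 \<longleftrightarrow> b3 * w^2 = b3 * (W r)^2"
      unfolding W eq_iff_add_eq_0[of "(T r)^2"] eq_iff_add_eq_0[of "b3 * w^2"] by (simp only: ac_simps)
    also have "\<dots> \<longleftrightarrow> w = W r" using b3 by (simp only: mult_cancel_left square_eq_iff) simp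
    finally show ?thesis .
  qed
  have sol: "(u,v,w) \<in> S \<longleftrightarrow> (\<exists>r. (u,v,w) = g r \<and> r \<noteq> 0 \<and> h (r^4) ((T r)^2) (W r) = 0)"
    for u v w
  proof -
    have "(u,v,w) \<in> S \<longleftrightarrow> (\<exists>r. u = r^4 \<and> (u,v,w) \<in> S)"
      by (metis sq_square p4)
    also have "\<dots> \<longleftrightarrow> (\<exists>r. u = r^4 \<and> v = (T r)^2 \<and> w = W r \<and> (r^4, (T r)^2, W r) \<noteq> (0,0,0)
       \<and> h (r^4) ((T r)^2) (W r) = 0)"
      by (auto simp only: S mem_Collect_eq prod.case eq1 eq2)
    also have "\<dots> \<longleftrightarrow> (\<exists>r. (u,v,w) = g r \<and> r \<noteq> 0 \<and> h (r^4) ((T r)^2) (W r) = 0)"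
      by (auto simp: g_def W_def T_def)
    finally show ?thesis .
  qed
  have pT: "polyfun 1 2 T" unfolding T_def
    by (intro polyfun_divide polyfun_add polyfun_cmult polyfun_mono[OF polyfun_id] polyfun_mono[OF polyfun_power2[OF polyfun_id]]) auto
  have p4': "polyfun 1 4 (\<lambda>r::'a. r^4)" by (rule polyfun_mono[OF polyfun_power4[OF polyfun_id]]) auto
  have pT2: "polyfun 1 4 (\<lambda>r. (T r)^2)" by (rule polyfun_mono[OF polyfun_power2[OF pT]]) auto
  have pW: "polyfun 1 4 W" unfolding W_def
    by (intro polyfun_divide polyfun_add polyfun_cmult polyfun_mono[OF pT] p4' pT2) auto
  \<comment> \<open>All three coordinates have degree at most 4 in \<open>r\<close> and vanish at
    \<open>r = 0\<close>, the parameter of the excluded origin.\<close>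
  have "polyfun (k * 1) (4 * 4) (\<lambda>r. h (r^4) ((T r)^2) (W r))"
    by (intro quartic_ordD[OF h] p4' pT2 pW) auto
  moreover have "S = g ` {r. r \<noteq> 0 \<and> h (r^4) ((T r)^2) (W r) = 0}"
    using sol by (auto simp: image_iff)
  ultimately have "card S \<le> 4 * 4 - k * 1"
    using inj fin by (intro card_image_polyfun_roots)
  then show ?thesis by simp
qed

text \<open>Adding \<open>c\<close> times the second equation to the first one cancels
  \<open>w^2\<close> there and leaves \<open>u + c * v\<close> on the left, which becomes the new
  first variable.\<close>

lemma card_solutions_curve:
  fixes h :: "'a \<Rightarrow> 'a \<Rightarrow> 'a \<Rightarrow> 'a"
  assumes h: "quartic_ord k h" and k: "k \<le> 8" and b3: "b3 \<noteq> 0"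
    and S: "S = {(u,v,w). (u,v,w) \<noteq> (0,0,0) \<and> u = g1 * u^2 + g2 * v^2 + g3 * w^2 \<and>
      v = b1 * u^2 + b2 * v^2 + b3 * w^2 \<and> h u v w = 0}"
    and fin: "finite S"
  shows "card S \<le> 16 - k"
proof -
  define c where "c = g3 / b3"
  define f where "f = (\<lambda>(u::'a,v::'a,w::'a). (u + c * v, v, w))"
  let ?G1 = "g1 + c * b1"
  \<comment> \<open>The terms with \<open>c^2\<close> arise from rewriting the old
    \<open>u^2\<close> as the new \<open>u^2\<close> plus \<open>c^2 * v^2\<close>. The summands
    \<open>0 * w\<close> bring \<open>h\<close> into the form of
    \<open>quartic_ord_linear\<close>.\<close>
  let ?S = "{(u,v,w). (u,v,w) \<noteq> (0,0,0) \<and> u = ?G1 * u^2 + (g2 + c * b2 + ?G1 * c^2) * v^2 \<and>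
      v = b1 * u^2 + (b2 + b1 * c^2) * v^2 + b3 * w^2 \<and> h (u + c * v + 0 * w) (v + 0 * w) w = 0}"
  have ff: "f (f x) = x" for x by (cases x) (simp add: f_def char2 ac_simps)
  have g3: "g3 = c * b3" using b3 by (simp add: c_def)
  have mem: "f (u,v,w) \<in> ?S \<longleftrightarrow> (u,v,w) \<in> S" for u v w
  proof -
    have 1: "v = b1 * (u + c * v)^2 + (b2 + b1 * c^2) * v^2 + b3 * w^2 \<longleftrightarrow>
      v = b1 * u^2 + b2 * v^2 + b3 * w^2"
      by (simp add: square_add algebra_simps two add_self_left power_mult_distrib)
    have 2: "u + c * v = ?G1 * (u + c * v)^2 + (g2 + c * b2 + ?G1 * c^2) * v^2 \<longleftrightarrow>
      u = g1 * u^2 + g2 * v^2 + g3 * w^2" if v: "v = b1 * u^2 + b2 * v^2 + b3 * w^2"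
    proof -
      have "u = g1 * u^2 + g2 * v^2 + g3 * w^2 \<longleftrightarrow>
         u + c * v = g1 * u^2 + g2 * v^2 + c * b3 * w^2 + c * (b1 * u^2 + b2 * v^2 + b3 * w^2)"
        unfolding g3 using v by (metis add_right_cancel)
      also have "g1 * u^2 + g2 * v^2 + c * b3 * w^2 + c * (b1 * u^2 + b2 * v^2 + b3 * w^2) =
         ?G1 * (u + c * v)^2 + (g2 + c * b2 + ?G1 * c^2) * v^2"
        by (simp add: square_add algebra_simps two add_self add_self_left power_mult_distrib)
      finally show ?thesis by blast
    qed
    show ?thesis
      unfolding S using 1 2 by (auto simp: f_def add_self add_self_left ac_simps)
  qed
  have eq: "?S = f ` S"
  proof (intro set_eqI iffI)
    fix x assume "x \<in> ?S"
    then have "f (f x) \<in> ?S" by (simp only: ff)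
    then have "f x \<in> S" using mem by (cases "f x") auto
    then show "x \<in> f ` S" using ff by (metis imageI)
  next
    fix x assume "x \<in> f ` S"
    then obtain u v w where "x = f (u,v,w)" "(u,v,w) \<in> S" by (metis imageE prod_cases3)
    then show "x \<in> ?S" by (simp only: mem)
  qed
  have "card ?S \<le> 16 - k"
    by (rule card_solutions_curve0[OF quartic_ord_linear[OF h] k b3 refl]) (unfold eq, use fin in simp)
  moreover have "inj_on f S" by (metis ff inj_onI)
  ultimately show ?thesis unfolding eq by (simp add: card_image)
qed

text \<open>The pair \<open>(u,v)\<close> is a fixed vector of a semilinear map of
  \<open>K^2\<close>, so there are at most 4 pairs. Each of them leaves a quartic in
  \<open>w\<close>; over \<open>(0,0)\<close> only the at most \<open>4 - k\<close> nonzero roots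
  count. The total is \<open>(4 - k) + 3 * 4\<close>.\<close>

lemma card_solutions_planes:
  fixes h :: "'a \<Rightarrow> 'a \<Rightarrow> 'a \<Rightarrow> 'a"
  assumes h: "quartic_ord k h" and k: "k \<le> 4"
    and S: "S = {(u,v,w). (u,v,w) \<noteq> (0,0,0) \<and> u = g1 * u^2 + g2 * v^2 \<and>
      v = b1 * u^2 + b2 * v^2 \<and> h u v w = 0}"
    and fin: "finite S"
  shows "card S \<le> 16 - k"
proof -
  define Y where "Y = {(u,v). u = g1 * u^2 + g2 * v^2 \<and> v = b1 * u^2 + b2 * v^2}"
  have Y: "finite Y" "card Y \<le> 4" using card_fixed2[of g1 g2 b1 b2] unfolding Y_def by auto
  let ?L = "\<lambda>(u,v). {(u',v',w). u' = u \<and> v' = v \<and> (u,v,w) \<noteq> (0,0,0) \<and> h u v w = 0}"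
  have S': "S = (\<Union>y\<in>Y. ?L y)" unfolding S Y_def by auto
  have finL: "finite (?L y)" if "y \<in> Y" for y
    using fin that unfolding S' by (metis (no_types, lifting) UN_upper finite_subset)
  have inj: "inj (\<lambda>w. (u, v, w))" for u v :: 'a by (auto simp: inj_on_def)
  have L: "card (?L y) \<le> (if y = (0,0) then 4 - k else 4)" if y: "y \<in> Y" for y
  proof (cases "y = (0,0)")
    case True
    have "polyfun (k * 1) (4 * 1) (\<lambda>w. h 0 0 w)"
      by (intro quartic_ordD[OF h] polyfun_zero polyfun_id) auto
    moreover have "?L y = (\<lambda>w. (0,0,w)) ` {w. w \<noteq> 0 \<and> h 0 0 w = 0}" using True by auto
    ultimately have "card (?L y) \<le> 4 * 1 - k * 1"
      using inj finL[OF y] by (intro card_image_polyfun_roots)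
    then show ?thesis using True by simp
  next
    case False
    obtain u v where uv: "y = (u,v)" by (cases y)
    have "polyfun (k * 0) (4 * 1) (\<lambda>w. h u v w)"
      by (intro quartic_ordD[OF h] polyfun_const polyfun_mono[OF polyfun_id]) auto
    then have "polyfun 0 4 (\<lambda>w. h u v w)" by simp
    moreover have "?L y = (\<lambda>w. (u,v,w)) ` {w. h u v w = 0}" using False uv by auto
    ultimately have "card (?L y) \<le> 4"
      using inj finL[OF y] by (intro card_image_polyfun_roots0)
    then show ?thesis using False by simp
  qed
  have z: "(0,0) \<in> Y" by (simp add: Y_def)
  have "card S \<le> (\<Sum>y\<in>Y. card (?L y))" unfolding S' using Y(1) by (rule card_UN_le)
  also have "\<dots> \<le> (\<Sum>y\<in>Y. if y = (0,0) then 4 - k else 4)" by (rule sum_mono) (rule L)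
  also have "\<dots> = (4 - k) + (\<Sum>y\<in>Y - {(0,0)}. 4)"
    by (subst sum.remove[OF Y(1) z]) (auto intro!: sum.cong)
  also have "\<dots> = (4 - k) + 4 * (card Y - 1)" using Y(1) z by simp
  also have "\<dots> \<le> 16 - k" using Y(2) k by linarith
  finally show ?thesis .
qed

lemma card_solutions:
  fixes h :: "'a \<Rightarrow> 'a \<Rightarrow> 'a \<Rightarrow> 'a"
  assumes h: "quartic_ord k h" and k: "k \<le> 4"
    and S: "S = {(u,v,w). (u,v,w) \<noteq> (0,0,0) \<and> u = g1 * u^2 + g2 * v^2 + g3 * w^2 \<and>
      v = b1 * u^2 + b2 * v^2 + b3 * w^2 \<and> h u v w = 0}"
    and fin: "finite S"
  shows "card S \<le> 16 - k"
proof -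
  consider "b3 \<noteq> 0" | "g3 \<noteq> 0" | "b3 = 0" "g3 = 0" by blast
  then show ?thesis
  proof cases
    case 1
    then show ?thesis using card_solutions_curve[OF h _ _ S fin] k by simp
  next
    case 2
    \<comment> \<open>Exchanging \<open>u\<close> and \<open>v\<close> exchanges the two equations
      and reduces to the first case.\<close>
    let ?f = "\<lambda>(u::'a,v::'a,w::'a). (v,u,w)"
    let ?S = "{(u,v,w). (u,v,w) \<noteq> (0,0,0) \<and> u = b2 * u^2 + b1 * v^2 + b3 * w^2 \<and>
      v = g2 * u^2 + g1 * v^2 + g3 * w^2 \<and> h v u w = 0}"
    have eq: "?S = ?f ` S" unfolding S by (auto simp: image_iff add.commute)
    have inj: "inj_on ?f S" by (auto simp: inj_on_def)
    have "k \<le> 8" "finite ?S" unfolding eq using k fin by auto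
    then have "card ?S \<le> 16 - k"
      using 2 by (intro card_solutions_curve[OF quartic_ord_swap[OF h] _ _ refl])
    then show ?thesis unfolding eq by (simp add: card_image[OF inj])
  next
    case 3
    then show ?thesis using card_solutions_planes[OF h k _ fin] S by simp
  qed
qed

end

section \<open>Counting points of projective space\<close>

definition proportional :: "'a::field \<times> 'a \<times> 'a \<times> 'a \<Rightarrow> 'a \<times> 'a \<times> 'a \<times> 'a \<Rightarrow> bool" where
  "proportional u v \<longleftrightarrow> (\<exists>c. c \<noteq> 0 \<and> v = scale4 c u)"

definition nonproportional :: "('a::field \<times> 'a \<times> 'a \<times> 'a) set \<Rightarrow> bool" where
  "nonproportional A \<longleftrightarrow> (\<forall>u\<in>A. \<forall>v\<in>A. proportional u v \<longrightarrow> u = v)"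

text \<open>Projective points are counted by sets of pairwise non-proportional representatives, so that
  no quotient has to be formed for the subsets into which the singular locus is split.\<close>

definition classes_finite :: "('a::field \<times> 'a \<times> 'a \<times> 'a) set \<Rightarrow> bool" where
  "classes_finite W \<longleftrightarrow> (\<forall>A\<subseteq>W. nonproportional A \<longrightarrow> finite A)"

definition classes_le :: "('a::field \<times> 'a \<times> 'a \<times> 'a) set \<Rightarrow> nat \<Rightarrow> bool" where
  "classes_le W n \<longleftrightarrow> (\<forall>A\<subseteq>W. nonproportional A \<longrightarrow> finite A \<and> card A \<le> n)"

interpretation vs4: vector_space "scale4 :: 'a::field \<Rightarrow> _"
  by unfold_locales (auto simp: scale4_def algebra_simps split: prod.splits)

lemma scale4_simp [simp]: "scale4 c (x1, x2, x3, z) = (c * x1, c * x2, c * x3, c * z)"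
  by (simp add: scale4_def)

lemma proportional_refl: "proportional u u"
  unfolding proportional_def by (metis vs4.scale_one zero_neq_one)

lemma proportional_sym: "proportional u v \<Longrightarrow> proportional v u"
  unfolding proportional_def by (metis nonzero_imp_inverse_nonzero left_inverse vs4.scale_one vs4.scale_scale)

lemma proportional_trans: "proportional u v \<Longrightarrow> proportional v w \<Longrightarrow> proportional u w"
  unfolding proportional_def by (metis vs4.scale_scale mult_eq_0_iff)

lemma nonproportional_subset: "nonproportional A \<Longrightarrow> B \<subseteq> A \<Longrightarrow> nonproportional B"
  unfolding nonproportional_def by blast

lemma classes_finite_subset: "classes_finite W \<Longrightarrow> W' \<subseteq> W \<Longrightarrow> classes_finite W'"
  unfolding classes_finite_def by blast

lemma classes_le_subset: "classes_le W n \<Longrightarrow> W' \<subseteq> W \<Longrightarrow> classes_le W' n"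
  unfolding classes_le_def by blast

lemma classes_le_mono: "classes_le W m \<Longrightarrow> m \<le> n \<Longrightarrow> classes_le W n"
  unfolding classes_le_def by (meson le_trans)

lemma classes_le_Un:
  assumes "classes_le W m" "classes_le W' n"
  shows "classes_le (W \<union> W') (m + n)"
  unfolding classes_le_def
proof (intro allI impI)
  fix A assume A: "A \<subseteq> W \<union> W'" "nonproportional A"
  have "finite (A \<inter> W) \<and> card (A \<inter> W) \<le> m" "finite (A \<inter> W') \<and> card (A \<inter> W') \<le> n"
    using assms A(2) unfolding classes_le_def by (meson Int_lower1 Int_lower2 nonproportional_subset)+
  moreover have "(A \<inter> W) \<union> (A \<inter> W') = A" using A by blast
  ultimately show "finite A \<and> card A \<le> m + n"
    using card_Un_le[of "A \<inter> W" "A \<inter> W'"] finite_UnI[of "A \<inter> W" "A \<inter> W'"] by simp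
qed

text \<open>Two vectors assigned to the same \<open>y\<close> are both proportional to
  \<open>g y\<close>, hence to each other, so the assignment is injective on non-proportional
  sets.\<close>

lemma classes_le_of_cover:
  assumes Y: "finite Y" and cov: "\<And>w. w \<in> W \<Longrightarrow> \<exists>y\<in>Y. proportional w (g y)"
  shows "classes_le W (card Y)"
  unfolding classes_le_def
proof (intro allI impI)
  fix A assume A: "A \<subseteq> W" "nonproportional A"
  obtain f where f: "\<And>w. w \<in> W \<Longrightarrow> f w \<in> Y \<and> proportional w (g (f w))" using cov by metis
  have "inj_on f A"
  proof (rule inj_onI)
    fix u v assume uv: "u \<in> A" "v \<in> A" "f u = f v"
    then have "proportional u (g (f u))" "proportional v (g (f u))" using f[of u] f[of v] A uv by auto
    then have "proportional u v" using proportional_sym proportional_trans by blast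
    then show "u = v" using A uv unfolding nonproportional_def by blast
  qed
  moreover have "f ` A \<subseteq> Y" using f A by blast
  ultimately show "finite A \<and> card A \<le> card Y"
    using Y by (meson card_inj_on_le inj_on_finite)
qed

text \<open>Used in two ways: to refute a line or conic of singular points, with the field minus at
  most one element as index set, and to show that the root solutions are finite in number.\<close>

lemma classes_finite_family:
  assumes W: "classes_finite W" and g: "\<And>i. i \<in> I \<Longrightarrow> g i \<in> W"
    and inj: "\<And>i j. i \<in> I \<Longrightarrow> j \<in> I \<Longrightarrow> proportional (g i) (g j) \<Longrightarrow> i = j"
  shows "finite I"
proof -
  have "nonproportional (g ` I)" unfolding nonproportional_def using inj by blast
  then have "finite (g ` I)" using W g unfolding classes_finite_def by blast
  moreover have "inj_on g I" using inj proportional_refl by (metis inj_onI)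
  ultimately show ?thesis by (rule finite_imageD)
qed

text \<open>In the application \<open>\<sigma>\<close> exchanges two coordinates.\<close>

lemma nonproportional_image:
  assumes "\<And>v. \<sigma> (\<sigma> v) = v" "\<And>c v. \<sigma> (scale4 c v) = scale4 c (\<sigma> v)" "nonproportional A"
  shows "nonproportional (\<sigma> ` A)"
  using assms unfolding nonproportional_def proportional_def by (metis imageE)

lemma classes_finite_vimage:
  assumes s: "\<And>v. \<sigma> (\<sigma> v) = v" "\<And>c v. \<sigma> (scale4 c v) = scale4 c (\<sigma> v)"
    and W: "classes_finite W"
  shows "classes_finite (\<sigma> -` W)"
  unfolding classes_finite_def
proof (intro allI impI)
  fix A assume A: "A \<subseteq> \<sigma> -` W" "nonproportional A"
  have "finite (\<sigma> ` A)" using W nonproportional_image[OF s A(2)] A(1) unfolding classes_finite_def by blast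
  moreover have "inj_on \<sigma> A" using s(1) by (metis inj_onI)
  ultimately show "finite A" by (rule finite_imageD)
qed

lemma classes_le_vimage:
  assumes s: "\<And>v. \<sigma> (\<sigma> v) = v" "\<And>c v. \<sigma> (scale4 c v) = scale4 c (\<sigma> v)"
    and W: "classes_le W n"
  shows "classes_le (\<sigma> -` W) n"
  unfolding classes_le_def
proof (intro allI impI)
  fix A assume A: "A \<subseteq> \<sigma> -` W" "nonproportional A"
  have "finite (\<sigma> ` A) \<and> card (\<sigma> ` A) \<le> n"
    using W nonproportional_image[OF s A(2)] A(1) unfolding classes_le_def by blast
  moreover have "inj_on \<sigma> A" using s(1) by (metis inj_onI)
  ultimately show "finite A \<and> card A \<le> n" by (metis card_image finite_imageD)
qed

lemma proj_rel_iff: "(u, v) \<in> proj_rel R \<longleftrightarrow> u \<in> R \<and> v \<in> R \<and> proportional u v"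
  by (auto simp: proj_rel_def proportional_def)

lemma equiv_proj_rel: "equiv R (proj_rel R)"
  by (rule equivI) (auto simp: refl_on_def sym_def trans_def proj_rel_iff
      intro: proportional_refl proportional_sym proportional_trans)

lemma classes_finite_sing_reps:
  assumes "finite (Sing F)"
  shows "classes_finite (sing_reps F)"
  unfolding classes_finite_def
proof (intro allI impI)
  fix A assume A: "A \<subseteq> sing_reps F" "nonproportional A"
  let ?cl = "\<lambda>v. proj_rel (sing_reps F) `` {v}"
  have "inj_on ?cl A"
  proof (rule inj_onI)
    fix u v assume uv: "u \<in> A" "v \<in> A" "?cl u = ?cl v"
    then have "(u, v) \<in> proj_rel (sing_reps F)"
      using A eq_equiv_class_iff[OF equiv_proj_rel] by blast
    then show "u = v" using A uv by (auto simp: proj_rel_iff nonproportional_def)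
  qed
  moreover have "?cl ` A \<subseteq> Sing F" using A by (auto simp: Sing_def quotient_def)
  ultimately show "finite A" using assms by (meson inj_on_finite)
qed

text \<open>Choosing a representative in every class gives a non-proportional set in bijection with
  \<open>Sing F\<close>.\<close>

lemma card_Sing_le:
  assumes "classes_le (sing_reps F) n"
  shows "card (Sing F) \<le> n"
proof -
  let ?R = "proj_rel (sing_reps F)"
  define f where "f = (\<lambda>C :: ('a \<times> 'a \<times> 'a \<times> 'a) set. SOME v. v \<in> C)"
  have f: "f C \<in> C" if "C \<in> Sing F" for C
    using in_quotient_imp_non_empty[OF equiv_proj_rel] that
    unfolding f_def Sing_def by (metis some_in_eq)
  have sub: "f ` Sing F \<subseteq> sing_reps F"
    using f in_quotient_imp_subset[OF equiv_proj_rel] unfolding Sing_def by blast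
  have eq: "C = D" if "C \<in> Sing F" "D \<in> Sing F" "proportional (f C) (f D)" for C D
    using that f sub quotient_eqI[OF equiv_proj_rel, of C "sing_reps F" D "f C" "f D"]
    unfolding Sing_def by (auto simp: proj_rel_iff)
  have "nonproportional (f ` Sing F)" unfolding nonproportional_def using eq by blast
  then have "card (f ` Sing F) \<le> n" using assms sub unfolding classes_le_def by blast
  moreover have "inj_on f (Sing F)" using eq proportional_refl by (metis inj_onI)
  ultimately show ?thesis by (simp add: card_image)
qed

section \<open>Singular points in square-root coordinates\<close>

definition lf :: "'a::field \<times> 'a \<times> 'a \<times> 'a \<Rightarrow> 'a \<times> 'a \<times> 'a \<times> 'a \<Rightarrow> 'a" where
  "lf a v = (case (a, v) of ((a1, a2, a3, a4), (x1, x2, x3, z)) \<Rightarrow> a1 * x1 + a2 * x2 + a3 * x3 + a4 * z)"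

lemma lf_simp [simp]: "lf (a1, a2, a3, a4) (x1, x2, x3, z) = a1 * x1 + a2 * x2 + a3 * x3 + a4 * z"
  by (simp add: lf_def)

lemma lf_add: "lf a (u + v) = lf a u + lf a v"
  by (cases a; cases u; cases v) (simp add: algebra_simps)

lemma lf_scale: "lf a (scale4 c v) = c * lf a v"
  by (cases a; cases v) (simp add: algebra_simps)

definition quad :: "('a::field \<times> 'a \<times> 'a \<times> 'a \<Rightarrow> 'a) \<Rightarrow> bool" where
  "quad S \<longleftrightarrow> (\<exists>s r1 r2 r3 d11 d22 d33 d12 d13 d23. \<forall>x1 x2 x3 z. S (x1, x2, x3, z) =
     s * z^2 + z * (r1 * x1 + r2 * x2 + r3 * x3)
      + d11 * x1^2 + d22 * x2^2 + d33 * x3^2 + d12 * x1 * x2 + d13 * x1 * x3 + d23 * x2 * x3)"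

lemma quad_scale:
  assumes "quad S"
  shows "S (scale4 c v) = c^2 * S v"
  using assms unfolding quad_def
  by (cases v) (auto simp: algebra_simps power2_eq_square)

text \<open>The witness is the polar form \<open>S (u + v) - S u - S v\<close>. Three vectors
  suffice because the quadric will be studied on lines and planes only.\<close>

lemma quad_polar:
  assumes "quad S"
  shows "\<exists>B. \<forall>u v w a b c. S (scale4 a u + scale4 b v + scale4 c w) =
     a^2 * S u + b^2 * S v + c^2 * S w + a * b * B u v + a * c * B u w + b * c * B v w"
proof -
  obtain s r1 r2 r3 d11 d22 d33 d12 d13 d23 where S: "\<And>x1 x2 x3 z. S (x1, x2, x3, z) =
     s * z^2 + z * (r1 * x1 + r2 * x2 + r3 * x3)
      + d11 * x1^2 + d22 * x2^2 + d33 * x3^2 + d12 * x1 * x2 + d13 * x1 * x3 + d23 * x2 * x3"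
    using assms unfolding quad_def by blast
  have "S (scale4 a u + scale4 b v + scale4 c w) =
     a^2 * S u + b^2 * S v + c^2 * S w + a * b * (S (u + v) - S u - S v)
      + a * c * (S (u + w) - S u - S w) + b * c * (S (v + w) - S v - S w)" for u v w a b c
    by (cases u; cases v; cases w) (simp add: S algebra_simps power2_eq_square)
  then show ?thesis by (intro exI[of _ "\<lambda>u v. S (u + v) - S u - S v"]) blast
qed

text \<open>The vectors with \<open>x\<close> parallel to \<open>(a\<^sup>2, b\<^sup>2, c\<^sup>2)\<close> and \<open>F = 0\<close>. The linear forms \<open>a, b, c\<close> are
  paired with \<open>x1, x2, x3\<close>, so that \<open>c\<^sup>2\<close> is the coefficient of \<open>x1 x2\<close>.\<close>

definition sing_locus :: "'a::field \<times> 'a \<times> 'a \<times> 'a \<Rightarrow> 'a \<times> 'a \<times> 'a \<times> 'a \<Rightarrow> 'a \<times> 'a \<times> 'a \<times> 'a \<Rightarrow> ('a \<times> 'a \<times> 'a \<times> 'a \<Rightarrow> 'a) \<Rightarrow> ('a \<times> 'a \<times> 'a \<times> 'a) set" where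
  "sing_locus a b c S = {(x1, x2, x3, z) | x1 x2 x3 z. (x1, x2, x3, z) \<noteq> (0, 0, 0, 0) \<and>
     x1 * (lf b (x1, x2, x3, z))^2 = x2 * (lf a (x1, x2, x3, z))^2 \<and>
     x1 * (lf c (x1, x2, x3, z))^2 = x3 * (lf a (x1, x2, x3, z))^2 \<and>
     x2 * (lf c (x1, x2, x3, z))^2 = x3 * (lf b (x1, x2, x3, z))^2 \<and>
     x1 * x2 * (lf c (x1, x2, x3, z))^2 + x1 * x3 * (lf b (x1, x2, x3, z))^2
       + x2 * x3 * (lf a (x1, x2, x3, z))^2 + (S (x1, x2, x3, z))^2 = 0}"

lemma mem_sing_locus_iff:
  "(x1, x2, x3, z) \<in> sing_locus a b c S \<longleftrightarrow> (x1, x2, x3, z) \<noteq> (0, 0, 0, 0) \<and>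
     x1 * (lf b (x1, x2, x3, z))^2 = x2 * (lf a (x1, x2, x3, z))^2 \<and>
     x1 * (lf c (x1, x2, x3, z))^2 = x3 * (lf a (x1, x2, x3, z))^2 \<and>
     x2 * (lf c (x1, x2, x3, z))^2 = x3 * (lf b (x1, x2, x3, z))^2 \<and>
     x1 * x2 * (lf c (x1, x2, x3, z))^2 + x1 * x3 * (lf b (x1, x2, x3, z))^2
       + x2 * x3 * (lf a (x1, x2, x3, z))^2 + (S (x1, x2, x3, z))^2 = 0"
  unfolding sing_locus_def by blast

definition kernel_part :: "'a::field \<times> 'a \<times> 'a \<times> 'a \<Rightarrow> 'a \<times> 'a \<times> 'a \<times> 'a \<Rightarrow> 'a \<times> 'a \<times> 'a \<times> 'a \<Rightarrow> ('a \<times> 'a \<times> 'a \<times> 'a \<Rightarrow> 'a) \<Rightarrow> ('a \<times> 'a \<times> 'a \<times> 'a) set" where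
  "kernel_part a b c S = {v. v \<noteq> 0 \<and> lf a v = 0 \<and> lf b v = 0 \<and> lf c v = 0 \<and> S v = 0}"

definition vertex_part :: "('a::field \<times> 'a \<times> 'a \<times> 'a \<Rightarrow> 'a) \<Rightarrow> ('a \<times> 'a \<times> 'a \<times> 'a) set" where
  "vertex_part S = {(0, 0, 0, z) | z. z \<noteq> 0 \<and> S (0, 0, 0, z) = 0}"

text \<open>The last equation is the square root of \<open>F = 0\<close>: at \<open>x = y^2\<close>
  the three mixed terms all equal \<open>(y1 y2 y3)^2\<close>, and three equal terms add up to one
  of them in characteristic 2.\<close>

definition root_solutions :: "'a::field \<times> 'a \<times> 'a \<times> 'a \<Rightarrow> 'a \<times> 'a \<times> 'a \<times> 'a \<Rightarrow> 'a \<times> 'a \<times> 'a \<times> 'a \<Rightarrow> ('a \<times> 'a \<times> 'a \<times> 'a \<Rightarrow> 'a) \<Rightarrow> ('a \<times> 'a \<times> 'a \<times> 'a) set" where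
  "root_solutions a b c S = {(y1, y2, y3, z). (y1, y2, y3) \<noteq> (0, 0, 0) \<and>
     y1 = lf a (y1^2, y2^2, y3^2, z) \<and> y2 = lf b (y1^2, y2^2, y3^2, z) \<and>
     y3 = lf c (y1^2, y2^2, y3^2, z) \<and> y1 * y2 * y3 + S (y1^2, y2^2, y3^2, z) = 0}"

definition root_point :: "'a::field \<times> 'a \<times> 'a \<times> 'a \<Rightarrow> 'a \<times> 'a \<times> 'a \<times> 'a" where
  "root_point y = (case y of (y1, y2, y3, z) \<Rightarrow> (y1^2, y2^2, y3^2, z))"

section \<open>The three kinds of singular points\<close>

context char2_closed
begin

lemma classes_le_kernel_part:
  fixes S :: "'a \<times> 'a \<times> 'a \<times> 'a \<Rightarrow> 'a"
  assumes S: "quad S" and W: "classes_finite (kernel_part a b c S)"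
  shows "classes_le (kernel_part a b c S) 2"
  unfolding classes_le_def
proof (intro allI impI)
  fix A assume A: "A \<subseteq> kernel_part a b c S" "nonproportional A"
  have finA: "finite A" using A W unfolding classes_finite_def by blast
  obtain B where B: "\<And>u v w a b c. S (scale4 a u + scale4 b v + scale4 c w) =
     a^2 * S u + b^2 * S v + c^2 * S w + a * b * B u v + a * c * B u w + b * c * B v w"
    using quad_polar[OF S] by blast
  have memW: "scale4 t1 u + scale4 t2 v + scale4 t3 w \<in> kernel_part a b c S"
    if "u \<in> kernel_part a b c S" "v \<in> kernel_part a b c S" "w \<in> kernel_part a b c S"
      "t1 * t2 * B u v + t1 * t3 * B u w + t2 * t3 * B v w = 0"
      "scale4 t1 u + scale4 t2 v + scale4 t3 w \<noteq> 0" for u v w t1 t2 t3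
    using that by (simp add: kernel_part_def lf_add lf_scale B)
  have nz: "u \<noteq> 0" "S u = 0" if "u \<in> A" for u using that A by (auto simp: kernel_part_def)
  have indep1: "t = 0" if "u \<in> A" "v \<in> A" "u \<noteq> v" "u = scale4 t v" for u v t
  proof (rule ccontr)
    assume "t \<noteq> 0"
    then have "proportional v u" unfolding proportional_def using that(4) by blast
    then show False using A(2) that(1-3) unfolding nonproportional_def by blast
  qed
  have indep2: "s = 0 \<and> t = 0" if "u \<in> A" "v \<in> A" "u \<noteq> v" "scale4 s u + scale4 t v = 0" for u v s t
  proof -
    have "s = 0"
    proof (rule ccontr)
      assume s: "s \<noteq> 0"
      have "scale4 (inverse s) (scale4 s u + scale4 t v) = 0" using that(4) by simp
      then have u: "u = scale4 (- (inverse s * t)) v"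
        using s by (simp add: vs4.scale_right_distrib vs4.scale_minus_left eq_neg_iff_add_eq_0)
      then have "- (inverse s * t) = 0" using indep1[OF that(1-3)] by blast
      then have "u = 0" using u by (metis vs4.scale_zero_left)
      then show False using nz(1)[OF that(1)] by simp
    qed
    then have "t = 0" using that nz(1)[OF that(2)] by simp
    with \<open>s = 0\<close> show ?thesis by simp
  qed
  \<comment> \<open>If \<open>B u v = 0\<close>, then \<open>S\<close> vanishes on the whole line
    through \<open>u\<close> and \<open>v\<close>, which consists of infinitely many points.\<close>
  have Bnz: "B u v \<noteq> 0" if uv: "u \<in> A" "v \<in> A" "u \<noteq> v" for u v
  proof
    assume B0: "B u v = 0"
    define g where "g = (\<lambda>t. scale4 1 u + scale4 t v)"
    have "finite (UNIV :: 'a set)"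
    proof (rule classes_finite_family[OF W, of _ g])
      fix t :: 'a
      have "g t \<noteq> 0" using indep2[OF uv, of 1 t] by (auto simp: g_def)
      then show "g t \<in> kernel_part a b c S"
        using memW[of u v v 1 t 0] uv A(1) B0 by (auto simp: g_def)
    next
      fix s t assume "proportional (g s) (g t)"
      then obtain k where "g t = scale4 k (g s)" unfolding proportional_def by blast
      then have "scale4 (1 - k) u + scale4 (t - k * s) v = 0"
        by (simp add: g_def vs4.scale_right_distrib vs4.scale_left_diff_distrib algebra_simps)
      then have "1 - k = 0" "t - k * s = 0" using indep2[OF uv] by blast+
      then show "s = t" by simp
    qed
    then show False using infinite_UNIV by simp
  qed
  show "finite A \<and> card A \<le> 2"
  proof (rule ccontr)
    assume "\<not> ?thesis"
    then have "3 \<le> card A" using finA by simp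
    then obtain D where D: "D \<subseteq> A" "card D = 3" using obtain_subset_with_card_n by metis
    then obtain p q r where pqr: "p \<in> A" "q \<in> A" "r \<in> A" "p \<noteq> q" "p \<noteq> r" "q \<noteq> r"
      by (auto simp: card_3_iff)
    \<comment> \<open>The points are not collinear: otherwise a multiple of \<open>r\<close> lies on
      the line through \<open>p\<close> and \<open>q\<close>, where \<open>S\<close> is
      \<open>t1 * t2 * B p q\<close>. So \<open>t1\<close> or \<open>t2\<close> is 0, and
      \<open>r\<close> is proportional to \<open>p\<close> or \<open>q\<close> or is zero.\<close>
    have indep3: "t1 = 0 \<and> t2 = 0 \<and> t3 = 0"
      if eq: "scale4 t1 p + scale4 t2 q + scale4 t3 r = 0" for t1 t2 t3
    proof -
      have "t3 = 0"
      proof (rule ccontr)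
        assume t3: "t3 \<noteq> 0"
        have "scale4 t1 p + scale4 t2 q + scale4 0 q = scale4 (- t3) r"
          using eq by (simp add: vs4.scale_minus_left eq_neg_iff_add_eq_0)
        then have "S (scale4 t1 p + scale4 t2 q + scale4 0 q) = S (scale4 (- t3) r)" by simp
        then have "t1 * t2 * B p q = 0"
          unfolding B quad_scale[OF S] using nz(2) pqr by simp
        then have "t1 = 0 \<or> t2 = 0" using Bnz pqr by simp
        then show False
          using eq indep2[of q r t2 t3] indep2[of p r t1 t3] pqr t3 by auto
      qed
      then show ?thesis using eq indep2[of p q t1 t2] pqr by simp
    qed
    \<comment> \<open>In the plane spanned by \<open>p, q, r\<close> the equation \<open>S = 0\<close> defines a conic, parametrised here by
      the lines through \<open>p\<close>.\<close>
    define m where "m = (\<lambda>t. t * B p q + B p r)"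
    define g where "g = (\<lambda>t. scale4 (t * B q r) p + scale4 (t * m t) q + scale4 (m t) r)"
    have "finite {t. m t \<noteq> 0}"
    proof (rule classes_finite_family[OF W, of _ g])
      fix t assume "t \<in> {t. m t \<noteq> 0}"
      then have "g t \<noteq> 0" using indep3[of "t * B q r" "t * m t" "m t"] by (auto simp: g_def)
      moreover have "t * B q r * (t * m t) * B p q + t * B q r * m t * B p r + t * m t * m t * B q r
          = t * B q r * m t * (m t + m t)"
        by (simp add: m_def algebra_simps)
      ultimately show "g t \<in> kernel_part a b c S"
        unfolding g_def using memW[of p q r "t * B q r" "t * m t" "m t"] pqr A(1)
        by (auto simp: add_self)
    next
      fix s t assume s: "s \<in> {t. m t \<noteq> 0}" and t: "t \<in> {t. m t \<noteq> 0}" and "proportional (g s) (g t)"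
      then obtain k where "g t = scale4 k (g s)" unfolding proportional_def by blast
      then have "scale4 (t * B q r - k * (s * B q r)) p + scale4 (t * m t - k * (s * m s)) q
          + scale4 (m t - k * m s) r = 0"
        by (simp add: g_def vs4.scale_right_distrib vs4.scale_left_diff_distrib algebra_simps)
      then have "t * m t - k * (s * m s) = 0" "m t - k * m s = 0" using indep3 by blast+
      then have "t * m t = s * m t" by (simp add: algebra_simps)
      then show "s = t" using t by simp
    qed
    \<comment> \<open>Since \<open>B p q\<close> is nonzero, \<open>m\<close> vanishes at a single
      parameter, and infinitely many points of the conic remain.\<close>
    moreover have "{t. m t \<noteq> 0} = UNIV - {B p r / B p q}"
      using Bnz[of p q] pqr eq_iff_add_eq_0 by (auto simp: m_def field_simps)
    ultimately show False using infinite_UNIV by simp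
  qed
qed

lemma classes_le_vertex_part:
  fixes S :: "'a \<times> 'a \<times> 'a \<times> 'a \<Rightarrow> 'a"
  assumes S: "quad S"
  shows "classes_le (vertex_part S) (if S (0, 0, 0, 1) = 0 then 1 else 0)"
proof -
  have eq: "S (0, 0, 0, z) = z^2 * S (0, 0, 0, 1)" for z
    using quad_scale[OF S, of z "(0,0,0,1)"] by simp
  show ?thesis
  proof (cases "S (0, 0, 0, 1) = 0")
    case True
    have "classes_le (vertex_part S) (card {()})"
      by (rule classes_le_of_cover[of _ _ "\<lambda>_. (0, 0, 0, 1)"])
         (auto simp: vertex_part_def proportional_def intro!: exI[of _ "inverse _"])
    then show ?thesis using True by simp
  next
    case False
    then have "S (0, 0, 0, z) \<noteq> 0" if "z \<noteq> 0" for z using eq[of z] that by simp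
    then have "vertex_part S = {}" by (auto simp: vertex_part_def)
    then show ?thesis using False by (auto simp: classes_le_def)
  qed
qed

text \<open>Away from the other two parts, \<open>x\<close> is a nonzero multiple
  \<open>\<mu>\<close> of \<open>(p^2, q^2, r^2)\<close>. Scaling \<open>v\<close> by
  \<open>\<mu>\<close> turns \<open>x\<close> into the squares of \<open>\<mu> * p\<close>,
  \<open>\<mu> * q\<close>, \<open>\<mu> * r\<close>, which are also the values of the linear forms
  at the scaled vector.\<close>

lemma sing_locus_subset:
  fixes S :: "'a \<times> 'a \<times> 'a \<times> 'a \<Rightarrow> 'a"
  assumes S: "quad S" and v: "v \<in> sing_locus a b c S" "v \<notin> kernel_part a b c S" "v \<notin> vertex_part S"
  shows "\<exists>y\<in>root_solutions a b c S. proportional v (root_point y)"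
proof -
  obtain x1 x2 x3 z where xz: "v = (x1, x2, x3, z)" by (cases v)
  define p q r where "p = lf a v" and "q = lf b v" and "r = lf c v"
  have h: "x1 * q^2 = x2 * p^2" "x1 * r^2 = x3 * p^2" "x2 * r^2 = x3 * q^2"
     "x1 * x2 * r^2 + x1 * x3 * q^2 + x2 * x3 * p^2 + (S v)^2 = 0" and v0: "v \<noteq> 0"
    using v(1) unfolding xz mem_sing_locus_iff p_def q_def r_def by (auto simp: zero_prod_def)
  have pqr: "p \<noteq> 0 \<or> q \<noteq> 0 \<or> r \<noteq> 0"
    using v(2) v0 h(4) by (auto simp: kernel_part_def p_def q_def r_def)
  have x: "x1 \<noteq> 0 \<or> x2 \<noteq> 0 \<or> x3 \<noteq> 0"
    using v(3) v0 h(4) by (auto simp: vertex_part_def xz zero_prod_def)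
  have "\<exists>\<mu>. x1 = \<mu> * p^2 \<and> x2 = \<mu> * q^2 \<and> x3 = \<mu> * r^2"
  proof -
    consider "p \<noteq> 0" | "q \<noteq> 0" | "r \<noteq> 0" using pqr by blast
    then show ?thesis
    proof cases
      case 1 then show ?thesis using h by (intro exI[of _ "x1 / p^2"]) (auto simp: field_simps)
    next
      case 2 then show ?thesis using h by (intro exI[of _ "x2 / q^2"]) (auto simp: field_simps)
    next
      case 3 then show ?thesis using h by (intro exI[of _ "x3 / r^2"]) (auto simp: field_simps)
    qed
  qed
  then obtain \<mu> where \<mu>: "x1 = \<mu> * p^2" "x2 = \<mu> * q^2" "x3 = \<mu> * r^2" by blast
  have "\<mu> \<noteq> 0" using x \<mu> by auto
  have "(\<mu> * p * q * r + S v)^2 = x1 * x2 * r^2 + x1 * x3 * q^2 + x2 * x3 * p^2 + (S v)^2"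
    by (simp add: \<mu> square_add power_mult_distrib)
       (simp add: power2_eq_square ac_simps add_self add_self_left three)
  then have Sv: "\<mu> * p * q * r + S v = 0" using h(4) by simp
  have pt: "scale4 \<mu> v = ((\<mu> * p)^2, (\<mu> * q)^2, (\<mu> * r)^2, \<mu> * z)"
    by (simp add: xz \<mu> power2_eq_square ac_simps)
  have "\<mu> * p * (\<mu> * q) * (\<mu> * r) + S (scale4 \<mu> v) = \<mu>^2 * (\<mu> * p * q * r + S v)"
    unfolding quad_scale[OF S] by (simp add: power2_eq_square algebra_simps)
  then have S0: "\<mu> * p * (\<mu> * q) * (\<mu> * r) + S (scale4 \<mu> v) = 0" using Sv by simp
  have l: "\<mu> * p = lf a (scale4 \<mu> v)" "\<mu> * q = lf b (scale4 \<mu> v)" "\<mu> * r = lf c (scale4 \<mu> v)"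
    by (simp_all only: lf_scale p_def q_def r_def)
  have "(\<mu> * p, \<mu> * q, \<mu> * r) \<noteq> (0, 0, 0)" using pqr \<open>\<mu> \<noteq> 0\<close> by auto
  then have "(\<mu> * p, \<mu> * q, \<mu> * r, \<mu> * z) \<in> root_solutions a b c S"
    unfolding root_solutions_def mem_Collect_eq prod.case pt[symmetric] using l S0 by blast
  moreover have "proportional v (root_point (\<mu> * p, \<mu> * q, \<mu> * r, \<mu> * z))"
    unfolding proportional_def root_point_def prod.case pt[symmetric] using \<open>\<mu> \<noteq> 0\<close> by blast
  ultimately show ?thesis by blast
qed

lemma root_point_mem_sing_locus: "y \<in> root_solutions a b c S \<Longrightarrow> root_point (y :: 'a \<times> 'a \<times> 'a \<times> 'a) \<in> sing_locus a b c S"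
proof -
  assume y: "y \<in> root_solutions a b c S"
  obtain y1 y2 y3 z where yz: "y = (y1, y2, y3, z)" by (cases y)
  have h: "(y1, y2, y3) \<noteq> (0, 0, 0)" "lf a (y1^2, y2^2, y3^2, z) = y1" "lf b (y1^2, y2^2, y3^2, z) = y2"
    "lf c (y1^2, y2^2, y3^2, z) = y3" "y1 * y2 * y3 + S (y1^2, y2^2, y3^2, z) = 0"
    using y by (auto simp: root_solutions_def yz)
  have "y1^2 * y2^2 * y3^2 + y1^2 * y3^2 * y2^2 + y2^2 * y3^2 * y1^2 + (S (y1^2, y2^2, y3^2, z))^2
      = (y1 * y2 * y3 + S (y1^2, y2^2, y3^2, z))^2"
    by (simp add: square_add power_mult_distrib ac_simps add_self add_self_left three)
  with h show ?thesis by (auto simp: yz root_point_def mem_sing_locus_iff simp del: lf_simp)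
qed

text \<open>A factor \<open>k\<close> between two root points multiplies the values \<open>y\<close>
  of the linear forms by \<open>k\<close> and also their squares by \<open>k\<close>. Hence
  \<open>k^2 = k\<close>, that is \<open>k = 1\<close>.\<close>

lemma finite_root_solutions:
  assumes "classes_finite (sing_locus a b c S)"
  shows "finite (root_solutions a b c S :: ('a \<times> 'a \<times> 'a \<times> 'a) set)"
proof (rule classes_finite_family[OF assms, of _ root_point])
  fix y y' assume y: "y \<in> root_solutions a b c S" and y': "y' \<in> root_solutions a b c S" and "proportional (root_point y) (root_point y')"
  then obtain k where k: "k \<noteq> 0" "root_point y' = scale4 k (root_point y)" unfolding proportional_def by blast
  obtain y1 y2 y3 z where yz: "y = (y1, y2, y3, z)" by (cases y)
  obtain y1' y2' y3' z' where yz': "y' = (y1', y2', y3', z')" by (cases y')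
  have l: "y1 = lf a (root_point y)" "y2 = lf b (root_point y)" "y3 = lf c (root_point y)" "(y1, y2, y3) \<noteq> (0, 0, 0)"
    using y by (auto simp: root_solutions_def yz root_point_def)
  have l': "y1' = lf a (root_point y')" "y2' = lf b (root_point y')" "y3' = lf c (root_point y')"
    using y' by (auto simp: root_solutions_def yz' root_point_def)
  have e: "y1' = k * y1" "y2' = k * y2" "y3' = k * y3" using l l' k(2) by (simp_all add: lf_scale)
  have "y1'^2 = k * y1^2" "y2'^2 = k * y2^2" "y3'^2 = k * y3^2" "z' = k * z"
    using k(2) by (simp_all add: yz yz' root_point_def)
  then have "k * (k - 1) * y1^2 = 0" "k * (k - 1) * y2^2 = 0" "k * (k - 1) * y3^2 = 0"
    unfolding e by (simp_all add: algebra_simps power2_eq_square)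
  then have "k = 1" using l(4) k(1) by auto
  then show "y = y'" using e \<open>z' = k * z\<close> by (simp add: yz yz')
qed (rule root_point_mem_sing_locus)

section \<open>The bound 16 for the singular locus\<close>

lemma classes_le_sing_locus:
  fixes S :: "'a \<times> 'a \<times> 'a \<times> 'a \<Rightarrow> 'a"
  assumes S: "quad S" and fin: "classes_finite (sing_locus a b c S)"
  shows "classes_le (kernel_part a b c S \<union> vertex_part S) n \<Longrightarrow> classes_le (sing_locus a b c S) (n + card (root_solutions a b c S))"
proof -
  assume n: "classes_le (kernel_part a b c S \<union> vertex_part S) n"
  let ?W = "{v \<in> sing_locus a b c S. v \<notin> kernel_part a b c S \<and> v \<notin> vertex_part S}"
  have "classes_le ?W (card (root_solutions a b c S))"
    using sing_locus_subset[OF S] by (intro classes_le_of_cover[OF finite_root_solutions[OF fin], of _ root_point]) auto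
  from classes_le_Un[OF n this] show ?thesis by (rule classes_le_subset) auto
qed

lemma kernel_part_subset: "kernel_part a b c S \<subseteq> sing_locus a b c S"
  by (auto simp: kernel_part_def mem_sing_locus_iff zero_prod_def)

text \<open>The last argument of \<open>S\<close> contains \<open>y3\<close> linearly, so it has
  order 1 only. Its square is the one term of order 2, with coefficient
  \<open>S (0, 0, 0, 1)\<close>; all other terms have order at least 3.\<close>

lemma quartic_ord_root_solutions:
  fixes S :: "'a \<times> 'a \<times> 'a \<times> 'a \<Rightarrow> 'a"
  assumes S: "quad S"
  shows "quartic_ord (if S (0, 0, 0, 1) = 0 then 3 else 2) (\<lambda>y1 y2 y3. y1 * y2 * y3 +
     S (y1^2, y2^2, y3^2, (y3 + c1 * y1^2 + c2 * y2^2 + c3 * y3^2) / c4))"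
  (is "quartic_ord ?k _")
proof -
  define k where "k = ?k"
  have "quartic_ord k (\<lambda>y1 y2 y3. y1 * y2 * y3 +
     S (y1^2, y2^2, y3^2, (y3 + c1 * y1^2 + c2 * y2^2 + c3 * y3^2) / c4))"
    unfolding quartic_ord_def
  proof (intro allI impI)
    fix m d :: nat and u v w :: "'a \<Rightarrow> 'a"
    assume u: "polyfun m d u" and v: "polyfun m d v" and w: "polyfun m d w"
    obtain s r1 r2 r3 d11 d22 d33 d12 d13 d23 where Sd: "\<And>x1 x2 x3 z. S (x1, x2, x3, z) =
       s * z^2 + z * (r1 * x1 + r2 * x2 + r3 * x3)
        + d11 * x1^2 + d22 * x2^2 + d33 * x3^2 + d12 * x1 * x2 + d13 * x1 * x3 + d23 * x2 * x3"
      using S unfolding quad_def by blast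
    have s: "S (0, 0, 0, 1) = s" by (simp add: Sd)
    define Z where "Z = (\<lambda>r. (w r + c1 * (u r)^2 + c2 * (v r)^2 + c3 * (w r)^2) / c4)"
    have Z: "polyfun m (2 * d) Z" unfolding Z_def
      by (intro polyfun_divide polyfun_add polyfun_cmult polyfun_power2_weak u v w polyfun_mono[OF w]) auto
    note sq = polyfun_power2[OF u] polyfun_power2[OF v] polyfun_power2[OF w]
    have k: "k * m \<le> 3 * m" by (simp add: k_def)
    have mono: "polyfun (k * m) (4 * d) f" if "polyfun m' d' f" "3 * m \<le> m'" "d' \<le> 4 * d" for m' d' f
      by (rule polyfun_mono[OF that(1)]) (use that k in linarith)+
    have 1: "polyfun (k * m) (4 * d) (\<lambda>r. u r * v r * w r)"
      by (rule mono[OF polyfun_mult[OF polyfun_mult[OF u v] w]]) auto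
    have 2: "polyfun (k * m) (4 * d) (\<lambda>r. s * (Z r)^2)"
      using s polyfun_mono[OF polyfun_cmult[OF polyfun_power2[OF Z]], of "2 * m" "4 * d" s] by (auto simp: polyfun_zero k_def)
    have 3: "polyfun (k * m) (4 * d) (\<lambda>r. Z r * (r1 * (u r)^2 + r2 * (v r)^2 + r3 * (w r)^2))"
      by (rule mono[OF polyfun_mult[OF Z polyfun_add[OF polyfun_add[OF polyfun_cmult polyfun_cmult] polyfun_cmult]]]) (rule sq | simp)+
    have 4: "polyfun (k * m) (4 * d) (\<lambda>r. e * ((f r)^2)^2)" if "polyfun m d f" for e f
      by (rule mono[OF polyfun_cmult[OF polyfun_power2[OF polyfun_power2[OF that]]]]) auto
    have 5: "polyfun (k * m) (4 * d) (\<lambda>r. e * (f r)^2 * (g r)^2)" if "polyfun m d f" "polyfun m d g" for e f g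
      by (rule mono[OF polyfun_mult[OF polyfun_cmult[OF polyfun_power2[OF that(1)]] polyfun_power2[OF that(2)]]]) auto
    show "polyfun (k * m) (4 * d) (\<lambda>r. u r * v r * w r + S ((u r)^2, (v r)^2, (w r)^2,
        (w r + c1 * (u r)^2 + c2 * (v r)^2 + c3 * (w r)^2) / c4))"
      unfolding Sd Z_def[symmetric] fun_cong[OF Z_def, symmetric]
      by (intro polyfun_add 1 2 3 4 5 u v w)
  qed
  then show ?thesis unfolding k_def .
qed

text \<open>The third equation determines \<open>z\<close>. Adding \<open>ka\<close> and
  \<open>kb\<close> times it to the other two removes \<open>z\<close> from them, and the new
  variables \<open>y1 + ka * y3\<close> and \<open>y2 + kb * y3\<close> give both the shape required
  by \<open>card_solutions\<close>.\<close>

lemma classes_le_sing_locus_inclined: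
  fixes S :: "'a \<times> 'a \<times> 'a \<times> 'a \<Rightarrow> 'a"
  assumes S: "quad S" and fin: "classes_finite (sing_locus (a1,a2,a3,a4) (b1,b2,b3,b4) (c1,c2,c3,c4) S)" and c4: "c4 \<noteq> 0"
  shows "classes_le (sing_locus (a1,a2,a3,a4) (b1,b2,b3,b4) (c1,c2,c3,c4) S) 16"
proof -
  let ?Y = "root_solutions (a1,a2,a3,a4) (b1,b2,b3,b4) (c1,c2,c3,c4) S"
  let ?k = "if S (0, 0, 0, 1) = 0 then 3 else 2 :: nat"
  define ka kb where "ka = a4 / c4" and "kb = b4 / c4"
  define A1 A2 A3 where "A1 = a1 + ka * c1" and "A2 = a2 + ka * c2" and "A3 = a3 + ka * c3"
  define B1 B2 B3 where "B1 = b1 + kb * c1" and "B2 = b2 + kb * c2" and "B3 = b3 + kb * c3"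
  define h where "h = (\<lambda>y1 y2 y3. y1 * y2 * y3 +
     S (y1^2, y2^2, y3^2, (y3 + c1 * y1^2 + c2 * y2^2 + c3 * y3^2) / c4))"
  have quartic_ord: "quartic_ord ?k h" unfolding h_def by (rule quartic_ord_root_solutions[OF S])
  define f where "f = (\<lambda>(y1::'a, y2::'a, y3::'a, z::'a). (y1 + ka * y3, y2 + kb * y3, y3))"
  \<comment> \<open>The extra coefficients of \<open>w^2\<close> come from the squares of
    \<open>y1 = u + ka * w\<close> and \<open>y2 = v + kb * w\<close>.\<close>
  let ?Sol = "{(u, v, w). (u, v, w) \<noteq> (0, 0, 0) \<and>
     u = A1 * u^2 + A2 * v^2 + (A3 + A1 * ka^2 + A2 * kb^2) * w^2 \<and>
     v = B1 * u^2 + B2 * v^2 + (B3 + B1 * ka^2 + B2 * kb^2) * w^2 \<and>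
     h (u + 0 * v + ka * w) (v + kb * w) w = 0}"
  have ka: "a4 = ka * c4" and kb: "b4 = kb * c4" using c4 by (simp_all add: ka_def kb_def)
  have z_eq: "y3 = lf (c1,c2,c3,c4) (y1^2, y2^2, y3^2, z) \<longleftrightarrow>
     z = (y3 + c1 * y1^2 + c2 * y2^2 + c3 * y3^2) / c4" for y1 y2 y3 z
  proof -
    have "z = (y3 + c1 * y1^2 + c2 * y2^2 + c3 * y3^2) / c4 \<longleftrightarrow>
        c4 * z = y3 + c1 * y1^2 + c2 * y2^2 + c3 * y3^2"
      using c4 by (auto simp: field_simps)
    then show ?thesis
      unfolding eq_iff_add_eq_0[of y3] eq_iff_add_eq_0[of "c4 * z"] by (simp add: ac_simps)
  qed
  have elim: "y = lf (e1,e2,e3,kk * c4) (x1, x2, x3, z) \<longleftrightarrow>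
      y + kk * y3 = (e1 + kk * c1) * x1 + (e2 + kk * c2) * x2 + (e3 + kk * c3) * x3"
    if "y3 = lf (c1,c2,c3,c4) (x1, x2, x3, z)" for y y3 e1 e2 e3 kk x1 x2 x3 z
  proof -
    have "lf (e1,e2,e3,kk * c4) (x1, x2, x3, z) =
       (e1 + kk * c1) * x1 + (e2 + kk * c2) * x2 + (e3 + kk * c3) * x3 + kk * y3"
      unfolding that by (simp add: algebra_simps add_self add_self_left two)
    then have "y = lf (e1,e2,e3,kk * c4) (x1, x2, x3, z) \<longleftrightarrow>
       y = (e1 + kk * c1) * x1 + (e2 + kk * c2) * x2 + (e3 + kk * c3) * x3 + kk * y3"
      by simp
    then show ?thesis
      unfolding eq_iff_add_eq_0[of y] eq_iff_add_eq_0[of "y + kk * y3"] by (simp add: ac_simps)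
  qed
  have shear: "E1 * (y1 + ka * y3)^2 + E2 * (y2 + kb * y3)^2 + (E3 + E1 * ka^2 + E2 * kb^2) * y3^2
     = E1 * y1^2 + E2 * y2^2 + E3 * y3^2" for E1 E2 E3 y1 y2 y3
    by (simp add: square_add algebra_simps add_self add_self_left two power_mult_distrib)
  have mem: "(y1, y2, y3, z) \<in> ?Y \<longleftrightarrow>
     (y1 + ka * y3, y2 + kb * y3, y3) \<in> ?Sol \<and> z = (y3 + c1 * y1^2 + c2 * y2^2 + c3 * y3^2) / c4"
    for y1 y2 y3 z
  proof -
    have nz: "(y1 + ka * y3, y2 + kb * y3, y3) \<noteq> (0, 0, 0) \<longleftrightarrow> (y1, y2, y3) \<noteq> (0, 0, 0)" by auto
    have undo: "y1 + ka * y3 + 0 * (y2 + kb * y3) + ka * y3 = y1" "y2 + kb * y3 + kb * y3 = y2"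
      by (simp_all add: ac_simps add_self add_self_left)
    show ?thesis
      unfolding root_solutions_def mem_Collect_eq prod.case nz undo shear
      using z_eq[of y3 y1 y2 z] elim[of y3 "y1^2" "y2^2" "y3^2" z y1 a1 a2 a3 ka]
        elim[of y3 "y1^2" "y2^2" "y3^2" z y2 b1 b2 b3 kb]
      unfolding ka[symmetric] kb[symmetric] A1_def A2_def A3_def B1_def B2_def B3_def h_def
      by blast
  qed
  have inj: "inj_on f ?Y"
  proof (rule inj_onI)
    fix y y' assume y: "y \<in> ?Y" "y' \<in> ?Y" "f y = f y'"
    obtain y1 y2 y3 z y1' y2' y3' z' where e: "y = (y1, y2, y3, z)" "y' = (y1', y2', y3', z')"
      by (cases y; cases y') auto
    have "y1 = y1'" "y2 = y2'" "y3 = y3'" using y(3) by (auto simp: e f_def)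
    moreover have "z = z'" using y(1,2) calculation unfolding e mem by blast
    ultimately show "y = y'" by (simp add: e)
  qed
  have "?Sol \<subseteq> f ` ?Y"
  proof
    fix x assume x: "x \<in> ?Sol"
    obtain u v w where uvw: "x = (u, v, w)" by (cases x)
    let ?y1 = "u + ka * w" and ?y2 = "v + kb * w"
    have "(?y1, ?y2, w, (w + c1 * ?y1^2 + c2 * ?y2^2 + c3 * w^2) / c4) \<in> ?Y"
      unfolding mem using x by (simp add: uvw add.assoc add_self)
    moreover have "x = f (?y1, ?y2, w, (w + c1 * ?y1^2 + c2 * ?y2^2 + c3 * w^2) / c4)"
      by (simp add: f_def uvw add.assoc add_self)
    ultimately show "x \<in> f ` ?Y" by blast
  qed
  moreover have "f ` ?Y \<subseteq> ?Sol"
    using mem unfolding f_def by (auto simp del: lf_simp)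
  ultimately have Sol: "?Sol = f ` ?Y" by blast
  have "card ?Sol \<le> 16 - ?k"
    by (rule card_solutions[OF quartic_ord_linear[OF quartic_ord] _ refl]) (unfold Sol, use finite_root_solutions[OF fin] in auto)
  then have cY: "card ?Y \<le> 16 - ?k" unfolding Sol by (simp add: card_image[OF inj])
  have "classes_le (kernel_part (a1,a2,a3,a4) (b1,b2,b3,b4) (c1,c2,c3,c4) S \<union> vertex_part S)
     (2 + (if S (0, 0, 0, 1) = 0 then 1 else 0))"
    by (intro classes_le_Un classes_le_kernel_part classes_le_vertex_part S classes_finite_subset[OF fin] kernel_part_subset)
  then have "classes_le (sing_locus (a1,a2,a3,a4) (b1,b2,b3,b4) (c1,c2,c3,c4) S)
     (2 + (if S (0, 0, 0, 1) = 0 then 1 else 0) + card ?Y)"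
    by (rule classes_le_sing_locus[OF S fin])
  \<comment> \<open>Either 2 + 0 + 14 or 2 + 1 + 13: when the vertex is singular, the order 3
    instead of 2 saves one root solution.\<close>
  moreover have "2 + (if S (0, 0, 0, 1) = 0 then 1 else 0) + card ?Y \<le> 16"
    using cY by (auto split: if_splits)
  ultimately show ?thesis by (rule classes_le_mono)
qed

text \<open>The \<open>y\<close> are the at most 7 nonzero fixed vectors of a semilinear map of
  \<open>K^3\<close>, each with at most two \<open>z\<close> because \<open>S\<close> is quadratic
  in \<open>z\<close>. With the kernel part this gives \<open>14 + 2\<close>.\<close>

lemma classes_le_sing_locus_split:
  fixes S :: "'a \<times> 'a \<times> 'a \<times> 'a \<Rightarrow> 'a"
  assumes S: "quad S" and fin: "classes_finite (sing_locus (a1,a2,a3,0) (b1,b2,b3,0) (c1,c2,c3,0) S)"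
  shows "classes_le (sing_locus (a1,a2,a3,0) (b1,b2,b3,0) (c1,c2,c3,0) S) 16"
proof -
  let ?Y = "root_solutions (a1,a2,a3,0) (b1,b2,b3,0) (c1,c2,c3,0) S"
  obtain s r1 r2 r3 d11 d22 d33 d12 d13 d23 where Sd: "\<And>x1 x2 x3 z. S (x1, x2, x3, z) =
     s * z^2 + z * (r1 * x1 + r2 * x2 + r3 * x3)
      + d11 * x1^2 + d22 * x2^2 + d33 * x3^2 + d12 * x1 * x2 + d13 * x1 * x3 + d23 * x2 * x3"
    using S unfolding quad_def by blast
  define Fix where "Fix = {(u,v,w). u = a1 * u^2 + a2 * v^2 + a3 * w^2 \<and>
     v = b1 * u^2 + b2 * v^2 + b3 * w^2 \<and> w = c1 * u^2 + c2 * v^2 + c3 * w^2}"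
  have Fix: "finite Fix" "card Fix \<le> 8"
    using card_fixed3[of a1 a2 a3 b1 b2 b3 c1 c2 c3] unfolding Fix_def by auto
  let ?L = "\<lambda>(u,v,w). (\<lambda>z. (u,v,w,z)) ` {z. u * v * w + S (u^2, v^2, w^2, z) = 0}"
  have Y: "?Y = (\<Union>y\<in>Fix - {(0,0,0)}. ?L y)"
    unfolding root_solutions_def Fix_def by auto
  have finY: "finite ?Y" by (rule finite_root_solutions[OF fin])
  have L: "card (?L y) \<le> 2" if y: "y \<in> Fix - {(0,0,0)}" for y
  proof -
    obtain u v w where uvw: "y = (u,v,w)" by (cases y)
    have inj: "inj (\<lambda>z. (u,v,w,z))" by (auto simp: inj_on_def)
    have sq: "polyfun 0 2 (\<lambda>z::'a. z^2)" by (rule polyfun_mono[OF polyfun_power2[OF polyfun_id]]) auto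
    have lin: "polyfun 0 2 (\<lambda>z::'a. z * c)" for c
      using polyfun_cmult[OF polyfun_mono[OF polyfun_id], of 0 2 c] by (simp add: mult.commute)
    have "polyfun 0 2 (\<lambda>z. u * v * w + S (u^2, v^2, w^2, z))"
      unfolding Sd by (intro polyfun_add polyfun_const polyfun_cmult sq lin)
    moreover have "finite (?L y)"
      using UN_upper[OF y, of ?L] finY unfolding Y by (rule finite_subset)
    ultimately show ?thesis
      unfolding uvw prod.case by (intro card_image_polyfun_roots0[OF _ refl inj])
  qed
  have z: "(0,0,0) \<in> Fix" by (simp add: Fix_def)
  have "card ?Y \<le> (\<Sum>y\<in>Fix - {(0,0,0)}. card (?L y))"
    unfolding Y using Fix(1) by (intro card_UN_le) auto
  also have "\<dots> \<le> (\<Sum>y\<in>Fix - {(0,0,0)}. 2)" by (rule sum_mono) (rule L)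
  also have "\<dots> = 2 * (card Fix - 1)" using Fix(1) z by simp
  finally have cY: "card ?Y \<le> 14" using Fix(2) by linarith
  have "classes_le (kernel_part (a1,a2,a3,0) (b1,b2,b3,0) (c1,c2,c3,0) S) 2"
    by (intro classes_le_kernel_part S classes_finite_subset[OF fin] kernel_part_subset)
  \<comment> \<open>Forms without \<open>z\<close> vanish at the vertex, so it is already
    counted.\<close>
  moreover have "vertex_part S \<subseteq> kernel_part (a1,a2,a3,0) (b1,b2,b3,0) (c1,c2,c3,0) S"
    by (auto simp: vertex_part_def kernel_part_def zero_prod_def)
  ultimately have "classes_le (kernel_part (a1,a2,a3,0) (b1,b2,b3,0) (c1,c2,c3,0) S \<union> vertex_part S) 2"
    by (simp add: Un_absorb2)
  then have "classes_le (sing_locus (a1,a2,a3,0) (b1,b2,b3,0) (c1,c2,c3,0) S) (2 + card ?Y)"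
    by (rule classes_le_sing_locus[OF S fin])
  then show ?thesis by (rule classes_le_mono) (use cY in simp)
qed

text \<open>Exchanging two of \<open>x1, x2, x3\<close> together with the paired forms maps the
  locus to one of the same kind, so a form that involves \<open>z\<close> can be moved to the third
  place.\<close>

lemma classes_le_sing_locus_16:
  fixes S :: "'a \<times> 'a \<times> 'a \<times> 'a \<Rightarrow> 'a"
  assumes S: "quad S" and fin: "classes_finite (sing_locus a b c S)"
  shows "classes_le (sing_locus a b c S) 16"
proof -
  obtain a1 a2 a3 a4 b1 b2 b3 b4 c1 c2 c3 c4
    where a: "a = (a1,a2,a3,a4)" and b: "b = (b1,b2,b3,b4)" and c: "c = (c1,c2,c3,c4)"
    by (metis prod_cases4)
  obtain s r1 r2 r3 d11 d22 d33 d12 d13 d23 where Sd: "\<And>x1 x2 x3 z. S (x1, x2, x3, z) =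
     s * z^2 + z * (r1 * x1 + r2 * x2 + r3 * x3)
      + d11 * x1^2 + d22 * x2^2 + d33 * x3^2 + d12 * x1 * x2 + d13 * x1 * x3 + d23 * x2 * x3"
    using S unfolding quad_def by blast
  consider "c4 \<noteq> 0" | "a4 \<noteq> 0" | "b4 \<noteq> 0" | "a4 = 0" "b4 = 0" "c4 = 0" by blast
  then show ?thesis
  proof cases
    case 1
    then show ?thesis using classes_le_sing_locus_inclined[OF S] fin unfolding a b c by blast
  next
    case 2
    define \<sigma> where "\<sigma> = (\<lambda>(x1::'a, x2::'a, x3::'a, z::'a). (x3, x2, x1, z))"
    have \<sigma>: "\<sigma> (\<sigma> v) = v" "\<sigma> (scale4 t v) = scale4 t (\<sigma> v)" for v t
      by (cases v; simp add: \<sigma>_def)+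
    let ?T = "sing_locus (c3,c2,c1,c4) (b3,b2,b1,b4) (a3,a2,a1,a4) (S \<circ> \<sigma>)"
    have "quad (S \<circ> \<sigma>)" unfolding quad_def
      by (rule exI[of _ s], rule exI[of _ r3], rule exI[of _ r2], rule exI[of _ r1],
          rule exI[of _ d33], rule exI[of _ d22], rule exI[of _ d11],
          rule exI[of _ d23], rule exI[of _ d13], rule exI[of _ d12])
         (simp add: \<sigma>_def Sd ac_simps)
    moreover have eq: "sing_locus a b c S = \<sigma> -` ?T"
      by (auto simp: a b c \<sigma>_def mem_sing_locus_iff ac_simps)
    moreover have "classes_finite (\<sigma> -` (\<sigma> -` ?T))"
      using classes_finite_vimage[OF \<sigma> fin] unfolding eq .
    then have "classes_finite ?T" by (simp add: vimage_def \<sigma>)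
    ultimately have "classes_le ?T 16" using 2 by (intro classes_le_sing_locus_inclined)
    then show ?thesis unfolding eq by (rule classes_le_vimage[OF \<sigma>])
  next
    case 3
    define \<sigma> where "\<sigma> = (\<lambda>(x1::'a, x2::'a, x3::'a, z::'a). (x1, x3, x2, z))"
    have \<sigma>: "\<sigma> (\<sigma> v) = v" "\<sigma> (scale4 t v) = scale4 t (\<sigma> v)" for v t
      by (cases v; simp add: \<sigma>_def)+
    let ?T = "sing_locus (a1,a3,a2,a4) (c1,c3,c2,c4) (b1,b3,b2,b4) (S \<circ> \<sigma>)"
    have "quad (S \<circ> \<sigma>)" unfolding quad_def
      by (rule exI[of _ s], rule exI[of _ r1], rule exI[of _ r3], rule exI[of _ r2],
          rule exI[of _ d11], rule exI[of _ d33], rule exI[of _ d22],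
          rule exI[of _ d13], rule exI[of _ d12], rule exI[of _ d23])
         (simp add: \<sigma>_def Sd ac_simps)
    moreover have eq: "sing_locus a b c S = \<sigma> -` ?T"
      by (auto simp: a b c \<sigma>_def mem_sing_locus_iff ac_simps)
    moreover have "classes_finite (\<sigma> -` (\<sigma> -` ?T))"
      using classes_finite_vimage[OF \<sigma> fin] unfolding eq .
    then have "classes_finite ?T" by (simp add: vimage_def \<sigma>)
    ultimately have "classes_le ?T 16" using 3 by (intro classes_le_sing_locus_inclined)
    then show ?thesis unfolding eq by (rule classes_le_vimage[OF \<sigma>])
  next
    case 4
    then show ?thesis using classes_le_sing_locus_split[OF S] fin unfolding a b c by blast
  qed
qed

text \<open>Square roots of coefficients turn the terms with even exponents into \<open>S^2\<close>
  and the cofactors of \<open>x2 x3\<close>, \<open>x1 x3\<close>, \<open>x1 x2\<close> into squares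
  of linear forms. A sum of two terms vanishes iff they are equal, so the gradient equations become
  the proportionality of \<open>x\<close> to the squared forms.\<close>

lemma sing_reps_eq_sing_locus:
  fixes lam :: 'a
  assumes F: "F = C4 lam * Z ^ 4 + Z ^ 2 * hom3 2 q + hom3 4 b"
  shows "\<exists>a b c S. quad S \<and> sing_reps F = sing_locus a b c S"
proof -
  define S where "S = (\<lambda>(x1, x2, x3, z). sq lam * z^2 + z * (sq (q 2 0 0) * x1 + sq (q 0 2 0) * x2 + sq (q 0 0 2) * x3)
     + sq (b 4 0 0) * x1^2 + sq (b 0 4 0) * x2^2 + sq (b 0 0 4) * x3^2
     + sq (b 2 2 0) * x1 * x2 + sq (b 2 0 2) * x1 * x3 + sq (b 0 2 2) * x2 * x3)"
  have quad: "quad S" unfolding quad_def S_def by (intro exI allI) (simp only: prod.case)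
  let ?a = "(sq (b 2 1 1), sq (b 0 3 1), sq (b 0 1 3), sq (q 0 1 1))"
  let ?b = "(sq (b 3 0 1), sq (b 1 2 1), sq (b 1 0 3), sq (q 1 0 1))"
  let ?c = "(sq (b 3 1 0), sq (b 1 3 0), sq (b 1 1 2), sq (q 1 1 0))"
  have "v \<in> sing_reps F \<longleftrightarrow> v \<in> sing_locus ?a ?b ?c S" for v
  proof -
    obtain x1 x2 x3 z where v: "v = (x1, x2, x3, z)" by (cases v)
    have pow4: "x^4 = (x^2)^2" for x :: 'a by simp
    have lf2: "(lf (sq e1, sq e2, sq e3, sq e4) (x1, x2, x3, z))^2 = e1 * x1^2 + e2 * x2^2 + e3 * x3^2 + e4 * z^2"
      for e1 e2 e3 e4
      by (simp add: square_add power_mult_distrib)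
    have S2: "(S (x1, x2, x3, z))^2 = lam * (z^2)^2 + z^2 * (q 2 0 0 * x1^2 + q 0 2 0 * x2^2 + q 0 0 2 * x3^2)
     + b 4 0 0 * (x1^2)^2 + b 0 4 0 * (x2^2)^2 + b 0 0 4 * (x3^2)^2
     + b 2 2 0 * x1^2 * x2^2 + b 2 0 2 * x1^2 * x3^2 + b 0 2 2 * x2^2 * x3^2"
      unfolding S_def prod.case by (simp only: square_add power_mult_distrib sq_square)
    show ?thesis
      unfolding v mem_sing_reps_iff[OF two F] mem_sing_locus_iff lf2 S2 pow4
        eq_iff_add_eq_0[of "x1 * _"] eq_iff_add_eq_0[of "x2 * _"]
      by (simp only: algebra_simps conj_ac)
  qed
  then show ?thesis using quad by blast
qed

end

theorem theorem2p6:
  fixes lam :: "'a::field"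
    and q b :: "nat \<Rightarrow> nat \<Rightarrow> nat \<Rightarrow> 'a"
    and F :: "'a mpoly4"
  assumes "alg_closed TYPE('a)"
    and "(2::'a) = 0"
    and "F = C4 lam * Z ^ 4 + Z ^ 2 * hom3 2 q + hom3 4 b"
    and "normal_surface F"
  shows "card (Sing F) \<le> 16"
proof -
  interpret char2_closed "TYPE('a)" using assms by unfold_locales
  obtain a b c S where S: "quad S" "sing_reps F = sing_locus a b c S"
    using sing_reps_eq_sing_locus[OF assms(3)] by blast
  have "classes_finite (sing_reps F)" using assms(4) by (intro classes_finite_sing_reps) (simp add: normal_surface_def)
  then have "classes_le (sing_reps F) 16" unfolding S(2) by (rule classes_le_sing_locus_16[OF S(1)])
  then show ?thesis by (rule card_Sing_le)
qed

end
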